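(* There exists a positive constant $u$ such that for all real $X\ge2$, $$\#\{n\le X: n \text{ is } \lambda^\star\text{-practical}\}\le u\,\frac{X}{\log X}.$$
   Context: $\lambda$ is the Carmichael function. A positive integer $n$ is $\lambda^\star$-practical if every positive integer $m\le\sum_{d\mid n}\lambda(d)$ can be written as $\sum_{d\in\mathcal{D}}\lambda(d)$ for some set $\mathcal{D}$ of distinct positive divisors of $n$. *)

theory Defs
  imports "HOL-Number_Theory.Number_Theory"
begin

definition lambda_star_practical :: "nat \<Rightarrow> bool" where
  "lambda_star_practical n \<longleftrightarrow> n > 0 \<and>
     (\<forall>m. 0 < m \<and> m \<le> (\<Sum>d | d dvd n. Carmichael d) \<longrightarrow>
        (\<exists>D. D \<subseteq> {d. d dvd n} \<and> m = (\<Sum>d\<in>D. Carmichael d)))"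

end

theory Submission
  imports Defs
begin

text \<open>
  If a prime \<open>p\<close> divides a practical number \<open>n\<close>, then the divisors involving a prime \<open>\<ge> p\<close> have
  \<open>\<lambda>(d) \<ge> p - 1\<close>, so \<open>p - 2\<close> must be a sum over divisors of the part \<open>m\<close> of \<open>n\<close> composed of primes
  \<open>< p\<close>; as \<open>\<lambda> \<le> \<phi>\<close> this sum is at most \<open>m\<close>, whence \<open>p \<le> m + 2\<close>. Let \<open>B\<^sub>y\<close> be the set of
  \<open>y\<close>-smooth numbers \<open>m\<close> all of whose \<open>z\<close>-smooth parts (\<open>z \<le> y\<close>) are at least \<open>z - 2\<close>.

  In the model where \<open>m\<close> is built prime by prime, \<open>ln m - ln y\<close> is essentially a martingale that is
  nonnegative as long as \<open>m\<close> stays in \<open>B\<^sub>y\<close>. This bounds \<open>\<Sum> (ln m - ln y) / m\<close> over \<open>B\<^sub>y\<close> by a constant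
  times \<open>ln y\<close>, saving a logarithm over all smooth numbers, and then \<open>\<Sum> 1 / m = O(1)\<close> and
  \<open>\<Sum> (ln m)\<^sup>2 / m = O((ln y)\<^sup>2)\<close>. Finally a practical \<open>n > T = X\<^bsup>1/4\<^esup>\<close> factors as \<open>m p r\<close> with
  \<open>m \<in> B\<^sub>p\<close>, \<open>m \<le> T < m p\<close> and \<open>r\<close> free of primes \<open>< p\<close>. A sieve bound leaves
  \<open>O(X / (m p ln p))\<close> choices of \<open>r\<close>, and the second moment makes the sum over \<open>m\<close> and \<open>p\<close> equal to
  \<open>O(X / (ln X)\<^sup>2) \<Sum> ln p / p = O(X / ln X)\<close>.
\<close>

section \<open>Elementary prime number estimates\<close>

lemma ln_Suc_diff_le: "n > 0 \<Longrightarrow> ln (real (Suc n)) - ln (real n) \<le> 1 / real n"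
  using ln_add_one_self_le_self[of "1 / real n"] ln_div[of "real (Suc n)" "real n"]
  by (simp add: add_divide_distrib add.commute)

lemma ln_Suc_diff_ge: "n > 0 \<Longrightarrow> ln (real (Suc n)) - ln (real n) \<ge> 1 / real (Suc n)"
proof -
  assume "n > 0"
  moreover have "real n / real (Suc n) = 1 - 1 / real (Suc n)"
    by (simp add: field_simps)
  ultimately show ?thesis
    using ln_le_minus_one[of "real n / real (Suc n)"] ln_div[of "real n" "real (Suc n)"] by simp
qed

text \<open>Passing from \<open>n\<close> to \<open>n + 1\<close> raises \<open>n div d\<close> by
  one exactly for \<open>d dvd n + 1\<close>, and \<open>mangoldt\<close> summed over these
  \<open>d\<close> is \<open>ln (n + 1)\<close>.\<close>

lemma sum_ln_conv_mangoldt: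
  "(\<Sum>k=1..n. ln (real k)) = (\<Sum>d=1..n. mangoldt d * real (n div d))"
proof (induction n)
  case (Suc n)
  have "(\<Sum>d=1..Suc n. mangoldt d * real (Suc n div d)) =
        (\<Sum>d=1..Suc n. mangoldt d * real (n div d)) +
        (\<Sum>d=1..Suc n. if d dvd Suc n then mangoldt d else 0)"
    unfolding sum.distrib[symmetric]
    by (intro sum.cong) (auto simp: div_Suc dvd_eq_mod_eq_0 algebra_simps)
  also have "(\<Sum>d=1..Suc n. if d dvd Suc n then mangoldt d else (0::real)) =
      (\<Sum>d | d dvd Suc n. mangoldt d)"
    by (intro sum.mono_neutral_cong_right)
       (auto simp: Suc_le_eq simp del: One_nat_def intro!: dvd_imp_le Nat.gr0I)
  also have "\<dots> = ln (real (Suc n))"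
    by (subst mangoldt_sum) auto
  also have "(\<Sum>d=1..Suc n. mangoldt d * real (n div d)) = (\<Sum>k=1..n. ln (real k))"
    using Suc by simp
  finally show ?case by simp
qed auto

section \<open>Chebyshev's function and its linear upper bound\<close>

definition psi :: "nat \<Rightarrow> real" where
  "psi n = (\<Sum>d=1..n. mangoldt d)"

lemma ln_fact_conv_sum: "ln (fact n :: real) = (\<Sum>k=1..n. ln (real k))"
  by (induction n) (auto simp: ln_mult)

text \<open>Chebyshev's argument: \<open>2n div d - 2 (n div d)\<close> is never negative and equals
  1 for \<open>n < d \<le> 2n\<close>; weighted by \<open>mangoldt\<close> it sums to the logarithm
  of the central binomial coefficient.\<close>

lemma psi_double_le: "psi (2 * n) \<le> psi n + 2 * real n * ln 2"
proof -
  have "psi (2 * n) - psi n = (\<Sum>d\<in>{n<..2*n}. mangoldt d)"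
  proof -
    have "{1..2*n} = {1..n} \<union> {n<..2*n}" by auto
    then have "psi (2 * n) = (\<Sum>d\<in>{1..n} \<union> {n<..2*n}. mangoldt d)"
      by (simp add: psi_def)
    also have "\<dots> = psi n + (\<Sum>d\<in>{n<..2*n}. mangoldt d)"
      unfolding psi_def by (intro sum.union_disjoint) auto
    finally show ?thesis by simp
  qed
  also have "\<dots> \<le> (\<Sum>d\<in>{n<..2*n}. mangoldt d * (real (2 * n div d) - 2 * real (n div d)))"
  proof (intro sum_mono)
    fix d assume d: "d \<in> {n<..2*n}"
    then have "2 * n div d = 1" "n div d = 0"
      by (auto simp: div_eq_0_iff intro!: div_nat_eqI)
    then show "mangoldt d \<le> mangoldt d * (real (2 * n div d) - 2 * real (n div d))" by simp
  qed
  also have "\<dots> \<le> (\<Sum>d=1..2*n. mangoldt d * (real (2 * n div d) - 2 * real (n div d)))"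
  proof (intro sum_mono2)
    fix d assume "d \<in> {1..2*n} - {n<..2*n}"
    have "2 * (n div d) \<le> 2 * n div d"
      by (cases "d = 0") (auto simp: less_eq_div_iff_mult_less_eq)
    then have "0 \<le> real (2 * n div d) - 2 * real (n div d)"
      by linarith
    then show "0 \<le> mangoldt d * (real (2 * n div d) - 2 * real (n div d))"
      by (intro mult_nonneg_nonneg mangoldt_nonneg)
  qed auto
  also have "\<dots> = (\<Sum>d=1..2*n. mangoldt d * real (2 * n div d))
                  - 2 * (\<Sum>d=1..2*n. mangoldt d * real (n div d))"
    by (simp add: algebra_simps sum_subtractf sum_distrib_left)
  also have "(\<Sum>d=1..2*n. mangoldt d * real (n div d)) = (\<Sum>d=1..n. mangoldt d * real (n div d))"
    by (intro sum.mono_neutral_right) auto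
  also have "(\<Sum>d=1..2*n. mangoldt d * real (2 * n div d)) - 2 * \<dots> = ln (fact (2 * n)) - 2 * ln (fact n)"
    by (simp only: ln_fact_conv_sum sum_ln_conv_mangoldt)
  also have "\<dots> = ln (fact (2 * n) / (fact n * fact n))"
    by (simp add: ln_div ln_mult)
  also have "fact (2 * n) / (fact n * fact n) = real (2 * n choose n)"
    by (subst binomial_fact) auto
  also have "ln \<dots> \<le> ln (2 ^ (2 * n))"
  proof -
    have "2 * n choose n \<le> 2 ^ (2 * n)"
      by (rule binomial_le_pow2)
    then have "real (2 * n choose n) \<le> 2 ^ (2 * n)"
      by (metis of_nat_le_iff of_nat_numeral of_nat_power)
    moreover have "(2 * n choose n) > 0" by simp
    ultimately show ?thesis by (subst ln_le_cancel_iff) auto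
  qed
  also have "\<dots> = 2 * real n * ln 2"
    by (simp add: ln_realpow)
  finally show ?thesis by simp
qed

lemma psi_Suc: "psi (Suc n) = psi n + mangoldt (Suc n)"
  by (simp add: psi_def)

lemma psi_le: "psi n \<le> 4 * real n"
proof (induction n rule: less_induct)
  case (less n)
  define k where "k = n div 2"
  have ln2: "ln (2::real) \<le> 1"
    using ln_le_minus_one[of "2::real"] by simp
  show ?case
  proof (cases "n = 0")
    case False
    then have "k < n" by (simp add: k_def)
    have "psi (2 * k) \<le> 4 * real k + 2 * real k * ln 2"
      using psi_double_le[of k] less[OF \<open>k < n\<close>] by linarith
    also have "\<dots> \<le> 4 * real k + 2 * real k * 1"
      using ln2 by (intro add_left_mono mult_left_mono) auto
    finally have *: "psi (2 * k) \<le> 6 * real k" by simp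
    consider "n = 2 * k" | "n = Suc (2 * k)" unfolding k_def by linarith
    then show ?thesis
    proof cases
      case 2
      \<comment> \<open>The bound \<open>6k\<close> for \<open>2k\<close> leaves slack
        \<open>2k + 4\<close> below \<open>4 (2k + 1)\<close>, enough for one more term.\<close>
      have "mangoldt (Suc (2 * k)) \<le> ln (real (Suc (2 * k)))"
        by (rule mangoldt_le) auto
      also have "\<dots> \<le> 2 * real k"
        using ln_le_minus_one[of "real (Suc (2 * k))"] by simp
      finally show ?thesis using * 2 by (simp add: psi_Suc)
    qed (use * in simp)
  qed (simp add: psi_def)
qed

section \<open>Mertens' first theorem with explicit constants\<close>

lemma sum_mangoldt_over_le:
  assumes "n > 0"
  shows "(\<Sum>d=1..n. mangoldt d / real d) \<le> ln (real n) + 4"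
proof -
  have "real n * (\<Sum>d=1..n. mangoldt d / real d) = (\<Sum>d=1..n. mangoldt d * (real n / real d))"
    by (simp add: sum_distrib_left mult_ac)
  \<comment> \<open>Rounding \<open>n / d\<close> costs at most \<open>psi n\<close> in total, which
    is where the constant 4 comes from.\<close>
  also have "\<dots> \<le> (\<Sum>d=1..n. mangoldt d * (real (n div d) + 1))"
  proof (intro sum_mono mult_left_mono mangoldt_nonneg)
    fix d assume "d \<in> {1..n}"
    then have "n \<le> (n div d + 1) * d"
      using dividend_less_div_times[of d n] by simp
    then have "real n \<le> real ((n div d + 1) * d)"
      by (rule of_nat_mono)
    then show "real n / real d \<le> real (n div d) + 1"
      using \<open>d \<in> {1..n}\<close> by (simp add: divide_le_eq algebra_simps)
  qed
  also have "\<dots> = (\<Sum>k=1..n. ln (real k)) + psi n"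
    unfolding sum_ln_conv_mangoldt psi_def by (simp add: algebra_simps sum.distrib)
  also have "\<dots> \<le> (\<Sum>k=1..n. ln (real n)) + 4 * real n"
    by (intro add_mono sum_mono psi_le) auto
  also have "\<dots> = real n * (ln (real n) + 4)"
    by (simp add: algebra_simps)
  finally show ?thesis using assms by simp
qed

lemma sum_mangoldt_over_ge:
  assumes "n > 0"
  shows "(\<Sum>d=1..n. mangoldt d / real d) \<ge> ln (real n) - 1"
proof -
  have "real n * ln (real n) - real n \<le> (\<Sum>k=1..n. ln (real k))"
    using assms
  proof (induction n rule: nat_induct_non_zero)
    case (Suc n)
    have "real n * (ln (real (Suc n)) - ln (real n)) \<le> real n * (1 / real n)"
      using Suc.hyps by (intro mult_left_mono ln_Suc_diff_le) auto
    with Suc show ?case by (simp add: algebra_simps)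
  qed auto
  also have "\<dots> \<le> (\<Sum>d=1..n. mangoldt d * (real n / real d))"
    unfolding sum_ln_conv_mangoldt
    by (intro sum_mono mult_left_mono mangoldt_nonneg of_nat_div_le_of_nat)
  also have "\<dots> = real n * (\<Sum>d=1..n. mangoldt d / real d)"
    by (simp add: sum_distrib_left mult_ac)
  finally have "real n * (ln (real n) - 1) \<le> real n * (\<Sum>d=1..n. mangoldt d / real d)"
    by (simp add: algebra_simps)
  then show ?thesis using assms by simp
qed

lemma sum_ln_over_primes_le:
  assumes "n > 0"
  shows "(\<Sum>p | prime p \<and> p \<le> n. ln (real p) / real p) \<le> ln (real n) + 4"
proof -
  have "(\<Sum>p | prime p \<and> p \<le> n. ln (real p) / real p) =
        (\<Sum>p | prime p \<and> p \<le> n. mangoldt p / real p)"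
    by (intro sum.cong) auto
  also have "\<dots> \<le> (\<Sum>d=1..n. mangoldt d / real d)"
    by (intro sum_mono2) (auto simp: mangoldt_nonneg dest: prime_gt_0_nat)
  also have "\<dots> \<le> ln (real n) + 4"
    by (rule sum_mangoldt_over_le[OF assms])
  finally show ?thesis .
qed

lemma primes_le_Suc:
  "{p::nat. prime p \<and> p \<le> Suc n} =
     (if prime (Suc n) then insert (Suc n) {p. prime p \<and> p \<le> n} else {p. prime p \<and> p \<le> n})"
  by (auto simp: le_Suc_eq)

text \<open>If every \<open>y\<close>-smooth \<open>m\<close> gets weight \<open>1 / m\<close>, then
  \<open>euler_prod y\<close> is the total weight and \<open>ell y\<close> the mean of
  \<open>ln m\<close>: the exponent of \<open>p\<close> has mean \<open>1 / (p - 1)\<close>.\<close>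

definition ell :: "nat \<Rightarrow> real" where
  "ell y = (\<Sum>p | prime p \<and> p \<le> y. ln (real p) / (real p - 1))"

definition euler_prod :: "nat \<Rightarrow> real" where
  "euler_prod y = (\<Prod>p | prime p \<and> p \<le> y. real p / (real p - 1))"

lemma ell_0 [simp]: "ell 0 = 0"
  and euler_prod_0 [simp]: "euler_prod 0 = 1"
proof -
  have *: "{p::nat. prime p \<and> p = 0} = {}" by auto
  show "ell 0 = 0" "euler_prod 0 = 1" by (simp_all add: ell_def euler_prod_def *)
qed

lemma ell_Suc: "ell (Suc y) = ell y + (if prime (Suc y) then ln (real (Suc y)) / real y else 0)"
  by (simp add: ell_def primes_le_Suc)

lemma euler_prod_Suc:
  "euler_prod (Suc y) = euler_prod y * (if prime (Suc y) then real (Suc y) / real y else 1)"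
  by (simp add: euler_prod_def primes_le_Suc)

lemma ell_nonneg: "ell y \<ge> 0"
  unfolding ell_def
  by (intro sum_nonneg divide_nonneg_nonneg) (auto dest: prime_gt_0_nat)

lemma euler_prod_pos: "euler_prod y > 0"
  unfolding euler_prod_def
  by (intro prod_pos) (auto simp: dest!: prime_gt_1_nat)

text \<open>The subtracted tail makes the induction close; it is chosen so that both sides vanish at
  \<open>n = 1\<close>.\<close>

lemma sum_ln_over_product_le:
  "n > 0 \<Longrightarrow> (\<Sum>k=2..n. ln (real k) / (real k * (real k - 1))) \<le> 2 - (ln (real n) + 2) / real n"
proof (induction n rule: nat_induct_non_zero)
  case (Suc n)
  define a b where "a = ln (real (Suc n))" and "b = ln (real n)"
  have n: "real n > 0" using Suc.hyps by simp
  have ab: "a - b \<le> 1 / real n"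
    unfolding a_def b_def by (rule ln_Suc_diff_le[OF Suc.hyps])
  have "real (Suc n) * (a - b) \<le> real (Suc n) * (1 / real n)"
    by (intro mult_left_mono ab) auto
  also have "\<dots> \<le> 2" using Suc.hyps by (simp add: field_simps)
  finally have *: "a + (a + 2) * real n \<le> (b + 2) * real (Suc n)"
    by (simp add: algebra_simps)
  have "a / (real (Suc n) * real n) + (a + 2) / real (Suc n) = (a + (a + 2) * real n) / (real (Suc n) * real n)"
    using n by (simp add: divide_simps)
  also have "\<dots> \<le> ((b + 2) * real (Suc n)) / (real (Suc n) * real n)"
    using * n by (intro divide_right_mono) auto
  also have "\<dots> = (b + 2) / real n"
    using n by (simp add: divide_simps)
  finally have "a / (real (Suc n) * real n) + (a + 2) / real (Suc n) \<le> (b + 2) / real n" .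
  then show ?case using Suc by (simp add: a_def b_def)
qed auto

text \<open>Since \<open>1 / (p - 1) = 1 / p + 1 / (p (p - 1))\<close>, the 6 is 4 from Mertens plus
  2 from a convergent series.\<close>

lemma ell_le:
  assumes "y > 0"
  shows "ell y \<le> ln (real y) + 6"
proof -
  have "ell y = (\<Sum>p | prime p \<and> p \<le> y. ln (real p) / real p) +
                (\<Sum>p | prime p \<and> p \<le> y. ln (real p) / (real p * (real p - 1)))"
    unfolding ell_def sum.distrib[symmetric]
    by (intro sum.cong) (auto simp: divide_simps algebra_simps dest!: prime_gt_1_nat)
  also have "(\<Sum>p | prime p \<and> p \<le> y. ln (real p) / (real p * (real p - 1)))
     \<le> (\<Sum>k=2..y. ln (real k) / (real k * (real k - 1)))"
    by (intro sum_mono2) (auto dest: prime_ge_2_nat)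
  also have "\<dots> \<le> 2 - (ln (real y) + 2) / real y"
    by (rule sum_ln_over_product_le[OF assms])
  also have "\<dots> \<le> 2"
    using assms by simp
  finally show ?thesis using sum_ln_over_primes_le[OF assms] by linarith
qed

text \<open>Partial summation from \<open>ell_le\<close>.\<close>
lemma sum_inverse_primes_le:
  assumes "n \<ge> 2"
  shows "(\<Sum>p | prime p \<and> p \<le> n. 1 / (real p - 1)) \<le>
           ell n / ln (real n) + ln (ln (real n)) - ln (ln 2) + 6 * (1 / ln 2 - 1 / ln (real n))"
  using assms
proof (induction n rule: nat_induct_at_least)
  case base
  have "{p::nat. prime p \<and> p \<le> 2} = {2}"
    by (auto dest: prime_ge_2_nat)
  then show ?case by (simp add: ell_def)
next
  case (Suc n)
  define a b where "a = ln (real (Suc n))" and "b = ln (real n)"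
  have b: "b > 0" and ab: "b < a" using Suc.hyps by (auto simp: a_def b_def)
  have inv: "1 / a \<le> 1 / b" using b ab by (simp add: frac_le)
  \<comment> \<open>Replacing the weight \<open>1 / b\<close> of \<open>ell n\<close> by
    \<open>1 / a\<close> is paid for by the growth of the \<open>ln ln\<close> term and of the term
    with factor 6.\<close>
  have "ell n * (1 / b - 1 / a) \<le> (b + 6) * (1 / b - 1 / a)"
    using ell_le[of n] Suc.hyps inv unfolding b_def by (intro mult_right_mono) auto
  also have "\<dots> = 1 - b / a + 6 * (1 / b - 1 / a)"
    using b ab by (simp add: field_simps)
  also have "1 - b / a \<le> ln a - ln b"
    using ln_le_minus_one[of "b / a"] b ab by (simp add: ln_div)
  finally have *: "ell n / b - ell n / a \<le> ln a - ln b + 6 * (1 / b - 1 / a)"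
    by (simp add: algebra_simps)
  show ?case
  proof (cases "prime (Suc n)")
    case True
    have "(\<Sum>p | prime p \<and> p \<le> Suc n. 1 / (real p - 1)) =
            1 / real n + (\<Sum>p | prime p \<and> p \<le> n. 1 / (real p - 1))"
      using True by (simp add: primes_le_Suc)
    also have "\<dots> \<le> 1 / real n + ell n / b + ln b - ln (ln 2) + 6 * (1 / ln 2 - 1 / b)"
      using Suc.IH by (simp add: b_def)
    also have "\<dots> \<le> (ell n / a + 1 / real n) + ln a - ln (ln 2) + 6 * (1 / ln 2 - 1 / a)"
      using * by (simp add: algebra_simps)
    also have "ell n / a + 1 / real n = ell (Suc n) / a"
      using True b ab by (simp add: ell_Suc a_def[symmetric] add_divide_distrib del: of_nat_Suc)
    finally show ?thesis by (simp only: a_def)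
  next
    case False
    then show ?thesis using Suc.IH *
      unfolding a_def[symmetric] b_def[symmetric] by (simp add: primes_le_Suc ell_Suc)
  qed
qed

text \<open>Upper half of Mertens' product theorem, from \<open>1 + t \<le> exp t\<close> with
  \<open>t = 1 / (p - 1)\<close>. Using \<open>ln (y + 1)\<close> keeps \<open>y = 1\<close>
  admissible.\<close>

lemma euler_prod_upper: "\<exists>C>0::real. \<forall>y\<ge>1. euler_prod y \<le> C * ln (real y + 1)"
proof (intro exI conjI allI impI)
  \<comment> \<open>The first summand serves \<open>y \<ge> 2\<close>; the second serves
    \<open>y = 1\<close>, where the product is empty.\<close>
  define C where "C = exp (1 + 6 / ln 2 - ln (ln 2)) + 1 / ln (2::real)"
  have ln2: "ln (2::real) > 0" by simp
  show "C > 0" using ln2 by (auto simp: C_def intro!: add_pos_pos)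
  fix y :: nat assume y: "y \<ge> 1"
  show "euler_prod y \<le> C * ln (real y + 1)"
  proof (cases "y = 1")
    case True
    have *: "{p::nat. prime p \<and> p \<le> Suc 0} = {}" by (auto dest: prime_ge_2_nat)
    show ?thesis using True by (simp add: euler_prod_def * C_def algebra_simps)
  next
    case False
    with y have y: "y \<ge> 2" by simp
    define b where "b = ln (real y)"
    have b: "b > 0" using y by (simp add: b_def)
    have "euler_prod y \<le> (\<Prod>p | prime p \<and> p \<le> y. exp (1 / (real p - 1)))"
      unfolding euler_prod_def
    proof (intro prod_mono conjI)
      fix p :: nat assume "p \<in> {p. prime p \<and> p \<le> y}"
      then have p: "real p > 1" by (auto dest: prime_gt_1_nat)
      then show "0 \<le> real p / (real p - 1)" by simp
      have "real p / (real p - 1) = 1 + 1 / (real p - 1)"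
        using p by (simp add: field_simps)
      also have "\<dots> \<le> exp (1 / (real p - 1))"
        by (rule exp_ge_add_one_self)
      finally show "real p / (real p - 1) \<le> exp (1 / (real p - 1))" .
    qed
    also have "\<dots> = exp (\<Sum>p | prime p \<and> p \<le> y. 1 / (real p - 1))"
      by (simp add: exp_sum)
    also have "(\<Sum>p | prime p \<and> p \<le> y. 1 / (real p - 1)) \<le>
        ell y / b + ln b - ln (ln 2) + 6 * (1 / ln 2 - 1 / b)"
      using sum_inverse_primes_le[OF y] by (simp add: b_def)
    also have "ell y / b \<le> (b + 6) / b"
      using ell_le[of y] y b by (intro divide_right_mono) (auto simp: b_def)
    also have "(b + 6) / b + ln b - ln (ln 2) + 6 * (1 / ln 2 - 1 / b) = (1 + 6 / ln 2 - ln (ln 2)) + ln b"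
      using b by (simp add: field_simps)
    also have "exp \<dots> = exp (1 + 6 / ln 2 - ln (ln 2)) * b"
      using b by (simp add: exp_add)
    also have "\<dots> \<le> C * ln (real y + 1)"
      using y b ln2 by (intro mult_mono) (auto simp: C_def b_def)
    finally show ?thesis by simp
  qed
qed

lemma ln_le_sum_inverse: "ln (real n + 1) \<le> (\<Sum>k=1..n. 1 / real k)"
proof (induction n)
  case (Suc n)
  then show ?case using ln_Suc_diff_le[of "Suc n"] by (simp add: algebra_simps)
qed auto

lemma sum_inverse_le_ln: "n > 0 \<Longrightarrow> (\<Sum>k=1..n. 1 / real k) \<le> 1 + ln (real n)"
proof (induction n rule: nat_induct_non_zero)
  case (Suc n)
  then show ?case using ln_Suc_diff_ge[of n] by simp
qed auto

section \<open>Smooth numbers with constrained smooth parts\<close>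

text \<open>These are the \<open>y\<close>-smooth numbers whose \<open>z\<close>-smooth part
  satisfies \<open>P z\<close> for every integer \<open>z\<close> from 1 to \<open>y\<close>. The
  recursion adds one prime at a time, as the inductions on \<open>y\<close> require; a trivial
  \<open>P\<close> yields all smooth numbers.\<close>

fun chain :: "(nat \<Rightarrow> nat \<Rightarrow> bool) \<Rightarrow> nat \<Rightarrow> nat set" where
  "chain P 0 = {1}"
| "chain P (Suc y) =
     {m \<in> (if prime (Suc y) then {a * Suc y ^ k | a k. a \<in> chain P y} else chain P y). P (Suc y) m}"

section \<open>The \<open>y\<close>-smooth part of a number\<close>

definition spart :: "nat \<Rightarrow> nat \<Rightarrow> nat" where
  "spart y n = (\<Prod>p | prime p \<and> p \<le> y. p ^ multiplicity p n)"

lemma spart_0 [simp]: "spart 0 n = 1"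
proof -
  have *: "{p::nat. prime p \<and> p = 0} = {}" by auto
  show ?thesis by (simp add: spart_def *)
qed

lemma spart_Suc:
  "spart (Suc y) n = spart y n * (if prime (Suc y) then Suc y ^ multiplicity (Suc y) n else 1)"
  by (simp add: spart_def primes_le_Suc)

lemma spart_pos: "spart y n > 0"
  unfolding spart_def by (intro prod_pos) (auto dest: prime_gt_0_nat)

lemma multiplicity_spart:
  assumes "prime q"
  shows "multiplicity q (spart y n) = (if q \<le> y then multiplicity q n else 0)"
  unfolding spart_def using assms
  by (subst multiplicity_prod_prime_powers) auto

lemma dvd_spartI:
  assumes "d > 0" "n > 0" "d dvd n" "\<And>q. prime q \<Longrightarrow> q dvd d \<Longrightarrow> q \<le> y"
  shows "d dvd spart y n"
proof (rule multiplicity_le_imp_dvd)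
  fix q :: nat assume q: "prime q"
  show "multiplicity q d \<le> multiplicity q (spart y n)"
  proof (cases "q dvd d")
    case True
    then show ?thesis using assms q
      by (auto simp: multiplicity_spart intro: dvd_imp_multiplicity_le)
  qed (simp add: not_dvd_imp_multiplicity_0)
qed (use assms spart_pos[of y n] in auto)

lemma spart_dvd:
  assumes "n > 0"
  shows "spart y n dvd n"
proof (rule multiplicity_le_imp_dvd)
  fix q :: nat assume q: "prime q"
  then show "multiplicity q (spart y n) \<le> multiplicity q n"
    by (simp add: multiplicity_spart)
qed (use assms spart_pos[of y n] in auto)

lemma spart_eq_self:
  assumes "n > 0" "n \<le> y"
  shows "spart y n = n"
  using assms by (intro dvd_antisym spart_dvd dvd_spartI) (auto dest: dvd_imp_le)

text \<open>The successive smooth parts of one number \<open>n\<close> follow the recursion of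
  \<open>chain\<close>.\<close>

lemma spart_in_chain:
  assumes "\<And>z. 1 \<le> z \<Longrightarrow> z \<le> y \<Longrightarrow> P z (spart z n)"
  shows "spart y n \<in> chain P y"
  using assms
proof (induction y)
  case (Suc y)
  then have "spart y n \<in> chain P y" "P (Suc y) (spart (Suc y) n)" by auto
  then show ?case by (auto simp: spart_Suc)
qed auto

lemma chain_pos: "m \<in> chain P y \<Longrightarrow> m > 0"
  by (induction y arbitrary: m) (auto split: if_splits)

lemma chain_constraint: "m \<in> chain P y \<Longrightarrow> y > 0 \<Longrightarrow> P y m"
  by (cases y) auto

text \<open>The factor \<open>q\<close> is inserted at its own level by raising the exponent there;
  all later smooth parts only grow, so a monotone \<open>P\<close> survives.\<close>

lemma chain_mult_prime:
  assumes "\<And>z a b. P z a \<Longrightarrow> a \<le> b \<Longrightarrow> P z b" "prime q" "q \<le> y" "m \<in> chain P y"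
  shows "m * q \<in> chain P y"
  using assms(3,4)
proof (induction y arbitrary: m)
  case (Suc y)
  have "m \<le> m * q" using prime_gt_0_nat[OF assms(2)] by simp
  with Suc.prems assms(1) have P: "P (Suc y) (m * q)" by auto
  show ?case
  proof (cases "prime (Suc y)")
    case True
    with Suc.prems obtain a k where a: "a \<in> chain P y" "m = a * Suc y ^ k" by auto
    show ?thesis
    proof (cases "q = Suc y")
      case True
      then have "m * q = a * Suc y ^ (k + 1)" using a by (simp add: algebra_simps)
      with a have "\<exists>b j. m * q = b * Suc y ^ j \<and> b \<in> chain P y" by blast
      then show ?thesis using P \<open>prime (Suc y)\<close> by simp
    next
      case False
      with Suc have "a * q \<in> chain P y" using a by simp
      moreover have "m * q = (a * q) * Suc y ^ k" using a by simp
      ultimately have "\<exists>b j. m * q = b * Suc y ^ j \<and> b \<in> chain P y" by blast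
      then show ?thesis using P \<open>prime (Suc y)\<close> by simp
    qed
  next
    case False
    then have "q \<noteq> Suc y" using assms by auto
    with Suc False P show ?thesis by auto
  qed
qed (use assms in auto)

text \<open>Since \<open>d \<le> y\<close>, all prime factors of \<open>d\<close> are at most
  \<open>y\<close> and can be inserted one by one.\<close>

lemma chain_mult:
  assumes "\<And>z a b. P z a \<Longrightarrow> a \<le> b \<Longrightarrow> P z b" "m \<in> chain P y"
  shows "d > 0 \<Longrightarrow> d \<le> y \<Longrightarrow> m * d \<in> chain P y"
proof (induction d rule: less_induct)
  case (less d)
  show ?case
  proof (cases "d = 1")
    case False
    with less.prems obtain q where q: "prime q" "q dvd d"
      using prime_factor_nat[of d] by auto
    then obtain e where e: "d = q * e" by auto
    have "e > 0" using less.prems e by (auto intro: Nat.gr0I)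
    then have "e < d" using e prime_gt_1_nat[OF q(1)] by simp
    with less \<open>e > 0\<close> have "m * e \<in> chain P y" by auto
    moreover have "q \<le> y" using q less.prems by (auto dest: dvd_imp_le)
    ultimately have "m * e * q \<in> chain P y" using assms(1) q(1) by (intro chain_mult_prime[of P q y "m * e"])
    then show ?thesis using e by (simp add: mult_ac)
  qed (use assms in simp)
qed

text \<open>The cutoff \<open>N\<close> makes the sums finite; the bounds on reciprocal sums and
  logarithmic moments below are uniform in \<open>N\<close>.\<close>

definition chain_le :: "(nat \<Rightarrow> nat \<Rightarrow> bool) \<Rightarrow> nat \<Rightarrow> nat \<Rightarrow> nat set" where
  "chain_le P y N = {m \<in> chain P y. m \<le> N}"

lemma finite_chain_le [simp]: "finite (chain_le P y N)"
  unfolding chain_le_def by (rule finite_subset[of _ "{..N}"]) auto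

lemma chain_le_pos: "m \<in> chain_le P y N \<Longrightarrow> m > 0"
  by (auto simp: chain_le_def chain_pos)

lemma chain_le_0: "chain_le P 0 N \<subseteq> {1}"
  by (auto simp: chain_le_def)

lemma sum_chain_Suc_not_prime:
  fixes f :: "nat \<Rightarrow> real"
  assumes "\<not> prime (Suc y)" "\<And>a. a \<in> chain P y \<Longrightarrow> f a \<ge> 0"
  shows "sum f (chain_le P (Suc y) N) \<le> sum f (chain_le P y N)"
  using assms by (intro sum_mono2) (auto simp: chain_le_def)

text \<open>The constraint at \<open>Suc y\<close> is dropped, so \<open>f\<close> must be
  nonnegative also on the products that it would discard. Exponents up to \<open>N\<close> suffice
  because \<open>k < 2 ^ k \<le> Suc y ^ k\<close>.\<close>

lemma sum_chain_Suc_prime: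
  fixes f :: "nat \<Rightarrow> real"
  assumes "prime (Suc y)" "\<And>a k. a \<in> chain P y \<Longrightarrow> f (a * Suc y ^ k) \<ge> 0"
  shows "sum f (chain_le P (Suc y) N) \<le> (\<Sum>a\<in>chain_le P y N. \<Sum>k\<le>N. f (a * Suc y ^ k))"
proof -
  let ?g = "\<lambda>(a, k). a * Suc y ^ k"
  let ?I = "chain_le P y N \<times> {..N}"
  have sub: "chain_le P (Suc y) N \<subseteq> ?g ` ?I"
  proof
    fix m assume "m \<in> chain_le P (Suc y) N"
    then obtain a k where a: "a \<in> chain P y" "m = a * Suc y ^ k" "m \<le> N"
      using assms by (auto simp: chain_le_def)
    have "a > 0" using a(1) by (rule chain_pos)
    have "a * 1 \<le> a * Suc y ^ k" by (intro mult_le_mono) auto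
    then have "a \<le> N" using a(2,3) by linarith
    have "k < 2 ^ k" by (rule less_exp)
    also have "2 ^ k \<le> Suc y ^ k"
      using prime_ge_2_nat[OF assms(1)] by (intro power_mono) auto
    also have "\<dots> \<le> a * Suc y ^ k" using \<open>a > 0\<close> by simp
    finally have "k \<le> N" using a by simp
    then show "m \<in> ?g ` ?I" using a \<open>a \<le> N\<close> by (force simp: chain_le_def)
  qed
  have "sum f (chain_le P (Suc y) N) \<le> sum f (?g ` ?I)"
    using sub assms(2) by (intro sum_mono2) (auto simp: chain_le_def)
  also have "\<dots> \<le> sum (f \<circ> ?g) ?I"
    using assms(2) by (intro sum_image_le) (auto simp: chain_le_def)
  also have "\<dots> = (\<Sum>a\<in>chain_le P y N. \<Sum>k\<le>N. f (a * Suc y ^ k))"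
    by (simp add: sum.cartesian_product split_def)
  finally show ?thesis .
qed

section \<open>Moments of the exponent of a single prime\<close>

lemma geometric_sum_le:
  fixes x :: real
  assumes "x > 1"
  shows "(\<Sum>k\<le>K. 1 / x ^ k) \<le> x / (x - 1)"
proof -
  have "(\<Sum>k\<le>K. 1 / x ^ k) = x / (x - 1) - 1 / ((x - 1) * x ^ K)"
    using assms by (induction K) (auto simp: divide_simps, auto simp: algebra_simps)
  also have "\<dots> \<le> x / (x - 1)" using assms by simp
  finally show ?thesis .
qed

lemma arith_geometric_sum_le:
  fixes x :: real
  assumes "x > 1"
  shows "(\<Sum>k\<le>K. real k / x ^ k) \<le> x / (x - 1)^2"
proof -
  have "(\<Sum>k\<le>K. real k / x ^ k) = x / (x - 1)^2 - (real K * (x - 1) + x) / ((x - 1)^2 * x ^ K)"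
  proof (induction K)
    case (Suc K)
    have nz: "(x - 1)^2 \<noteq> 0" "x ^ K \<noteq> 0" "x \<noteq> 0" using assms by auto
    have "(real K * (x - 1) + x) / ((x - 1)^2 * x ^ K) - real (Suc K) / x ^ Suc K =
          (real (Suc K) * (x - 1) + x) / ((x - 1)^2 * x ^ Suc K)"
      using nz by (simp add: divide_simps) (simp add: power2_eq_square algebra_simps)
    with Suc show ?case by simp
  qed (use assms in auto)
  also have "\<dots> \<le> x / (x - 1)^2" using assms by simp
  finally show ?thesis .
qed

text \<open>For \<open>k \<ge> 1\<close>, \<open>x ^ k\<close> is at least
  \<open>x * 2 ^ (k - 1)\<close>, which reduces the claim to base 2, where the full series equals
  6.\<close>

lemma square_geometric_sum_le:
  fixes x :: real
  assumes "x \<ge> 2"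
  shows "(\<Sum>k\<le>K. real k ^ 2 / x ^ k) \<le> 12 / x"
proof -
  have "(\<Sum>k\<le>K. real k ^ 2 / x ^ k) \<le> (\<Sum>k\<le>K. 2 / x * (real k ^ 2 / 2 ^ k))"
  proof (intro sum_mono)
    fix k
    show "real k ^ 2 / x ^ k \<le> 2 / x * (real k ^ 2 / 2 ^ k)"
    proof (cases k)
      case (Suc j)
      have "2 ^ j \<le> x ^ j" using assms by (intro power_mono) auto
      then have "real k ^ 2 / (x * x ^ j) \<le> real k ^ 2 / (x * 2 ^ j)"
        using assms by (intro divide_left_mono mult_left_mono) auto
      then show ?thesis by (simp add: Suc)
    qed auto
  qed
  also have "\<dots> = 2 / x * (\<Sum>k\<le>K. real k ^ 2 / 2 ^ k)"
    by (simp add: sum_distrib_left)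
  also have "(\<Sum>k\<le>K. real k ^ 2 / 2 ^ k) = 6 - (real K ^ 2 + 4 * real K + 6) / 2 ^ K"
    by (induction K) (auto simp: field_simps power2_eq_square)
  also have "2 / x * \<dots> \<le> 2 / x * 6"
    using assms by (intro mult_left_mono) auto
  finally show ?thesis by simp
qed

text \<open>Used with \<open>x = p\<close> and \<open>L = ln p\<close>: averaging over the exponent
  yields the Euler factor and shifts \<open>c\<close> by \<open>L / (x - 1)\<close>, the increment
  of \<open>ell\<close>.\<close>

lemma sum_prime_powers_affine_le:
  fixes x a c L :: real
  assumes "x > 1" "a > 0" "L \<ge> 0" "c \<ge> 0"
  shows "(\<Sum>k\<le>K. (c + real k * L) / (a * x ^ k)) \<le> x / (x - 1) * ((c + L / (x - 1)) / a)"
proof -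
  have "(\<Sum>k\<le>K. (c + real k * L) / (a * x ^ k)) =
        (c * (\<Sum>k\<le>K. 1 / x ^ k) + L * (\<Sum>k\<le>K. real k / x ^ k)) / a"
    by (simp add: sum_distrib_left sum.distrib[symmetric] sum_divide_distrib add_divide_distrib mult_ac)
  also have "\<dots> \<le> (c * (x / (x - 1)) + L * (x / (x - 1)^2)) / a"
    using assms
    by (intro divide_right_mono add_mono mult_left_mono geometric_sum_le arith_geometric_sum_le) auto
  also have "\<dots> = x / (x - 1) * ((c + L / (x - 1)) / a)"
    using assms by (simp add: power2_eq_square add_divide_distrib algebra_simps)
  finally show ?thesis .
qed

text \<open>The second-moment analogue: besides \<open>c^2 / a\<close> it involves the first moment
  \<open>c / a\<close> and the mass \<open>1 / a\<close>, with the Euler factor pulled out.\<close>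

lemma sum_prime_powers_square_le:
  fixes x a c L :: real
  assumes "x \<ge> 2" "a > 0" "L \<ge> 0" "c \<ge> 0"
  shows "(\<Sum>k\<le>K. (c + real k * L)^2 / (a * x ^ k)) \<le>
           x / (x - 1) * (c^2 / a + 2 * L / (x - 1) * (c / a) + 12 * L^2 / (x - 1) * (1 / a))"
proof -
  have "(\<Sum>k\<le>K. (c + real k * L)^2 / (a * x ^ k)) =
        (c^2 * (\<Sum>k\<le>K. 1 / x ^ k) + 2 * c * L * (\<Sum>k\<le>K. real k / x ^ k)
          + L^2 * (\<Sum>k\<le>K. real k ^ 2 / x ^ k)) / a"
    unfolding sum_distrib_left sum.distrib[symmetric] sum_divide_distrib
    by (intro sum.cong refl) (simp add: power2_eq_square add_divide_distrib algebra_simps)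
  also have "\<dots> \<le> (c^2 * (x / (x - 1)) + 2 * c * L * (x / (x - 1)^2) + L^2 * (12 / x)) / a"
    using assms
    by (intro divide_right_mono add_mono mult_left_mono geometric_sum_le arith_geometric_sum_le
          square_geometric_sum_le) auto
  also have "\<dots> \<le> (c^2 * (x / (x - 1)) + 2 * c * L * (x / (x - 1)^2) + L^2 * (x / (x - 1) * (12 / (x - 1)))) / a"
  proof -
    have "12 / x \<le> 12 / (x - 1)" using assms by (intro divide_left_mono) auto
    also have "\<dots> = 1 * (12 / (x - 1))" by simp
    also have "\<dots> \<le> x / (x - 1) * (12 / (x - 1))"
      using assms by (intro mult_right_mono) auto
    finally show ?thesis using assms by (intro divide_right_mono add_mono mult_left_mono) auto
  qed
  also have "\<dots> = x / (x - 1) * (c^2 / a + 2 * L / (x - 1) * (c / a) + 12 * L^2 / (x - 1) * (1 / a))"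
    using assms by (simp add: power2_eq_square add_divide_distrib algebra_simps)
  finally show ?thesis .
qed

text \<open>Each prime contributes at most its Euler factor, and constraints only remove
  terms.\<close>

lemma sum_inverse_chain_le: "(\<Sum>m\<in>chain_le P y N. 1 / real m) \<le> euler_prod y"
proof (induction y)
  case 0
  have "(\<Sum>m\<in>chain_le P 0 N. 1 / real m) \<le> (\<Sum>m\<in>{1}. 1 / real m)"
    by (intro sum_mono2 chain_le_0) auto
  then show ?case by simp
next
  case (Suc y)
  show ?case
  proof (cases "prime (Suc y)")
    case True
    let ?p = "real (Suc y)"
    have p: "?p > 1" using prime_gt_1_nat[OF True] by simp
    have "(\<Sum>m\<in>chain_le P (Suc y) N. 1 / real m) \<le>
          (\<Sum>a\<in>chain_le P y N. \<Sum>k\<le>N. 1 / real (a * Suc y ^ k))"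
      by (intro sum_chain_Suc_prime True) auto
    also have "\<dots> = (\<Sum>a\<in>chain_le P y N. 1 / real a * (\<Sum>k\<le>N. 1 / ?p ^ k))"
      by (simp add: sum_distrib_left)
    also have "\<dots> \<le> (\<Sum>a\<in>chain_le P y N. 1 / real a * (?p / (?p - 1)))"
      using p by (intro sum_mono mult_left_mono geometric_sum_le) auto
    also have "\<dots> = (\<Sum>a\<in>chain_le P y N. 1 / real a) * (?p / (?p - 1))"
      by (rule sum_distrib_right[symmetric])
    also have "\<dots> \<le> euler_prod y * (?p / (?p - 1))"
      using p Suc by (intro mult_right_mono) auto
    finally show ?thesis using True by (simp add: euler_prod_Suc)
  next
    case False
    then show ?thesis
      using sum_chain_Suc_not_prime[of y P "\<lambda>m. 1 / real m" N] Suc by (simp add: euler_prod_Suc)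
  qed
qed

text \<open>With the trivial constraint the chain contains every \<open>m \<le> y\<close>, so the
  product dominates a harmonic sum.\<close>

lemma euler_prod_lower: "euler_prod y \<ge> ln (real y + 1)"
proof -
  have "ln (real y + 1) \<le> (\<Sum>k=1..y. 1 / real k)" by (rule ln_le_sum_inverse)
  also have "\<dots> \<le> (\<Sum>m\<in>chain_le (\<lambda>_ _. True) y y. 1 / real m)"
  proof (intro sum_mono2)
    show "{1..y} \<subseteq> chain_le (\<lambda>_ _. True) y y"
    proof
      fix m assume "m \<in> {1..y}"
      then show "m \<in> chain_le (\<lambda>_ _. True) y y"
        using spart_in_chain[of y "\<lambda>_ _. True" m] by (simp add: chain_le_def spart_eq_self)
    qed
  qed auto
  also have "\<dots> \<le> euler_prod y" by (rule sum_inverse_chain_le)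
  finally show ?thesis .
qed

section \<open>Logarithmic moments\<close>

text \<open>Practicality gives \<open>z \<le> m + 1\<close> for \<open>z\<close> below a prime
  divisor \<open>p\<close>; the 2 lets the condition hold at \<open>z = p\<close> as well.\<close>

definition dense_step :: "nat \<Rightarrow> nat \<Rightarrow> bool" where
  "dense_step z m \<longleftrightarrow> z \<le> m + 2"

lemma dense_step_mono: "dense_step z a \<Longrightarrow> a \<le> b \<Longrightarrow> dense_step z b"
  by (simp add: dense_step_def)

lemma dense_chain_lower:
  assumes "m \<in> chain dense_step y"
  shows "y \<le> m + 2" "y \<le> 3 * m"
  using chain_constraint[OF assms] chain_pos[OF assms] by (cases "y = 0"; simp add: dense_step_def)+

lemma ln_3_le: "ln (3::real) \<le> 2" and ln_4_le: "ln (4::real) \<le> 3"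
  using ln_le_minus_one[of "3::real"] ln_le_minus_one[of "4::real"] by simp_all

lemma ell_mono_Suc: "ell y \<le> ell (Suc y)"
  by (simp add: ell_Suc)

text \<open>Keeps the weight \<open>ln a + 9 - ell\<close> nonnegative even after \<open>ell\<close>
  has moved on to \<open>Suc y\<close>. The 9 is 6 from \<open>ell_le\<close> plus 3 for
  \<open>ln 4\<close>, as \<open>Suc y \<le> 4 * a\<close>.\<close>

lemma ell_Suc_le_dense_chain:
  assumes "a \<in> chain dense_step y"
  shows "ell (Suc y) \<le> ln (real a) + 9"
proof -
  have a: "a > 0" "Suc y \<le> 4 * a"
    using dense_chain_lower(2)[OF assms] chain_pos[OF assms] by auto
  have "ell (Suc y) \<le> ln (real (Suc y)) + 6" by (rule ell_le) auto
  also have "ln (real (Suc y)) \<le> ln (4 * real a)"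
    using a by (subst ln_le_cancel_iff) auto
  also have "\<dots> = ln 4 + ln (real a)" using a by (simp add: ln_mult)
  finally show ?thesis using ln_4_le by linarith
qed

text \<open>The weight \<open>ln m + 9 - ell y\<close> is harmonic for the step from \<open>y\<close> to the next prime \<open>p\<close>:
  averaging over the powers \<open>p ^ k\<close> adds exactly \<open>ln p / (p - 1) = ell p - ell (p - 1)\<close> to \<open>ln m\<close>.
  Since it is nonnegative on the numbers that get discarded, the sum grows no faster than the Euler product.\<close>
lemma sum_height_dense_chain_le:
  "(\<Sum>m\<in>chain_le dense_step y N. (ln (real m) + 9 - ell y) / real m) \<le> 9 * euler_prod y"
proof (induction y)
  case 0
  have "(\<Sum>m\<in>chain_le dense_step 0 N. (ln (real m) + 9 - ell 0) / real m) \<le>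
        (\<Sum>m\<in>{1}. (ln (real m) + 9 - ell 0) / real m)"
    by (intro sum_mono2 chain_le_0) auto
  then show ?case by simp
next
  case (Suc y)
  show ?case
  proof (cases "prime (Suc y)")
    case True
    define p where "p = real (Suc y)"
    have p: "p > 1" using prime_gt_1_nat[OF True] by (simp add: p_def)
    have lnp: "ln p \<ge> 0" using p by simp
    have ell: "ell (Suc y) = ell y + ln p / (p - 1)"
      using True by (simp add: ell_Suc p_def)
    let ?f = "\<lambda>m. (ln (real m) + 9 - ell (Suc y)) / real m"
    have f: "?f (a * Suc y ^ k) = ((ln (real a) + 9 - ell (Suc y)) + real k * ln p) / (real a * p ^ k)"
      if "a \<in> chain dense_step y" for a k
      using chain_pos[OF that] p
      by (simp add: p_def[symmetric] ln_mult ln_realpow del: of_nat_Suc)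
    have "sum ?f (chain_le dense_step (Suc y) N) \<le>
          (\<Sum>a\<in>chain_le dense_step y N. \<Sum>k\<le>N. ?f (a * Suc y ^ k))"
    proof (intro sum_chain_Suc_prime True)
      fix a k assume a: "a \<in> chain dense_step y"
      show "?f (a * Suc y ^ k) \<ge> 0"
        unfolding f[OF a] using p lnp ell_Suc_le_dense_chain[OF a] by (intro divide_nonneg_nonneg) auto
    qed
    also have "\<dots> \<le> (\<Sum>a\<in>chain_le dense_step y N.
        p / (p - 1) * (((ln (real a) + 9 - ell (Suc y)) + ln p / (p - 1)) / real a))"
    proof (intro sum_mono)
      fix a assume "a \<in> chain_le dense_step y N"
      then have a: "a \<in> chain dense_step y" by (simp add: chain_le_def)
      show "(\<Sum>k\<le>N. ?f (a * Suc y ^ k)) \<le>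
            p / (p - 1) * (((ln (real a) + 9 - ell (Suc y)) + ln p / (p - 1)) / real a)"
        unfolding f[OF a] using p lnp chain_pos[OF a] ell_Suc_le_dense_chain[OF a]
        by (intro sum_prime_powers_affine_le) auto
    qed
    \<comment> \<open>The mean gain \<open>ln p / (p - 1)\<close> cancels the increment of
      \<open>ell\<close>, restoring the weight at level \<open>y\<close>.\<close>
    also have "\<dots> = p / (p - 1) * (\<Sum>a\<in>chain_le dense_step y N. (ln (real a) + 9 - ell y) / real a)"
      unfolding sum_distrib_left by (intro sum.cong refl) (simp add: ell add_ac)
    also have "\<dots> \<le> p / (p - 1) * (9 * euler_prod y)"
      using p Suc by (intro mult_left_mono) auto
    also have "\<dots> = 9 * euler_prod (Suc y)"
      using True by (simp add: euler_prod_Suc p_def mult_ac)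
    finally show ?thesis .
  next
    case False
    have "(\<Sum>m\<in>chain_le dense_step (Suc y) N. (ln (real m) + 9 - ell y) / real m) \<le>
          (\<Sum>m\<in>chain_le dense_step y N. (ln (real m) + 9 - ell y) / real m)"
    proof (intro sum_chain_Suc_not_prime False)
      fix a assume "a \<in> chain dense_step y"
      then show "(ln (real a) + 9 - ell y) / real a \<ge> 0"
        using ell_Suc_le_dense_chain[of a y] ell_mono_Suc[of y] by auto
    qed
    with Suc False show ?thesis by (simp add: ell_Suc euler_prod_Suc)
  qed
qed

text \<open>Multiplying a member of the chain by the prime powers between \<open>sqrt y\<close> and \<open>y\<close> moves it
  well above \<open>y\<close>, where the weight above is comparable to \<open>ln m\<close>.\<close>
lemma sum_inverse_dense_chain_aux:
  assumes y: "y \<ge> 1"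
  shows "(\<Sum>m\<in>chain_le dense_step y N. 1 / real m) * (ln (real y) / 2 - 5) \<le> 27 * euler_prod y"
proof -
  define s where "s = nat \<lfloor>sqrt (real y)\<rfloor>"
  have s_le: "real s \<le> sqrt (real y)" unfolding s_def by (simp add: of_nat_nat)
  have s1: "s \<ge> 1" using y by (simp add: s_def le_nat_iff le_floor_iff)
  have "sqrt (real y) \<le> real y" using y by (intro real_le_lsqrt) (auto simp: power2_eq_square)
  with s_le have sy: "s \<le> y" by linarith
  define D where "D = {s<..y}"
  define A where "A = chain_le dense_step y N"
  define M where "M = {m \<in> chain_le dense_step y (N * y). real y * sqrt (real y) \<le> 3 * real m}"
  have D_gt: "real d \<ge> sqrt (real y)" if "d \<in> D" for d
    using that unfolding D_def s_def by (simp add: floor_less_iff) linarith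
  \<comment> \<open>Mertens at \<open>y\<close> and at \<open>s\<close>:
    \<open>(ln y - 1) - (ln y / 2 + 4)\<close>.\<close>
  have "ln (real y) / 2 - 5 \<le> (\<Sum>d\<in>D. mangoldt d / real d)"
  proof -
    have "{1..y} = {1..s} \<union> D" using sy by (auto simp: D_def)
    then have "(\<Sum>d=1..y. mangoldt d / real d) = (\<Sum>d\<in>{1..s} \<union> D. mangoldt d / real d)"
      by simp
    also have "\<dots> = (\<Sum>d=1..s. mangoldt d / real d) + (\<Sum>d\<in>D. mangoldt d / real d)"
      by (intro sum.union_disjoint) (auto simp: D_def)
    finally have eq: "(\<Sum>d=1..y. mangoldt d / real d) =
      (\<Sum>d=1..s. mangoldt d / real d) + (\<Sum>d\<in>D. mangoldt d / real d)" .
    have "ln (real s) \<le> ln (sqrt (real y))"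
      using s1 s_le y by (subst ln_le_cancel_iff) auto
    also have "\<dots> = ln (real y) / 2" using y by (simp add: ln_sqrt)
    finally have "ln (real s) \<le> ln (real y) / 2" .
    with eq sum_mangoldt_over_ge[of y] sum_mangoldt_over_le[of s] s1 y show ?thesis by simp
  qed
  then have "(\<Sum>m\<in>A. 1 / real m) * (ln (real y) / 2 - 5) \<le>
      (\<Sum>m\<in>A. 1 / real m) * (\<Sum>d\<in>D. mangoldt d / real d)"
    by (intro mult_left_mono sum_nonneg) auto
  also have "\<dots> = (\<Sum>(m,d)\<in>A \<times> D. mangoldt d / real (m * d))"
    by (simp add: sum_product sum.cartesian_product)
  also have "\<dots> = (\<Sum>(k,d)\<in>(\<lambda>(m,d). (m * d, d)) ` (A \<times> D). mangoldt d / real k)"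
    by (subst sum.reindex) (auto simp: inj_on_def D_def split_def)
  \<comment> \<open>Each product \<open>k = m * d\<close> lies in the chain and is at least
    \<open>y * sqrt y / 3\<close>; allowing all divisors \<open>d\<close> of \<open>k\<close> makes
    the inner sum \<open>ln k\<close>.\<close>
  also have "\<dots> \<le> (\<Sum>(k,d)\<in>(SIGMA k:M. {d. d dvd k}). mangoldt d / real k)"
  proof (intro sum_mono2)
    show "finite (SIGMA k:M. {d. d dvd k})"
      by (intro finite_SigmaI finite_divisors_nat) (auto simp: M_def chain_le_pos)
    show "(\<lambda>(m,d). (m * d, d)) ` (A \<times> D) \<subseteq> (SIGMA k:M. {d. d dvd k})"
    proof safe
      fix m d assume m: "m \<in> A" and d: "d \<in> D"
      have mc: "m \<in> chain dense_step y" "m \<le> N" using m by (auto simp: A_def chain_le_def)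
      have "m * d \<in> chain dense_step y"
        using d mc dense_step_mono by (intro chain_mult) (auto simp: D_def)
      moreover have "m * d \<le> N * y"
        using mc d by (intro mult_le_mono) (auto simp: D_def)
      moreover have "real y * sqrt (real y) \<le> (3 * real m) * real d"
      proof (intro mult_mono D_gt d)
        have "real y \<le> real (3 * m)" using dense_chain_lower(2)[OF mc(1)] by (rule of_nat_mono)
        then show "real y \<le> 3 * real m" by simp
      qed auto
      ultimately show "m * d \<in> M" by (simp add: M_def chain_le_def)
    qed auto
  qed (auto simp: mangoldt_nonneg)
  also have "\<dots> = (\<Sum>k\<in>M. \<Sum>d | d dvd k. mangoldt d / real k)"
    by (subst sum.Sigma) (auto simp: M_def intro!: finite_divisors_nat chain_le_pos)
  also have "\<dots> = (\<Sum>k\<in>M. ln (real k) / real k)"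
  proof (intro sum.cong refl)
    fix k assume "k \<in> M"
    then have "k > 0" by (auto simp: M_def chain_le_pos)
    then show "(\<Sum>d | d dvd k. mangoldt d / real k) = ln (real k) / real k"
      using mangoldt_sum[of k, where ?'a = real] by (simp add: sum_divide_distrib[symmetric])
  qed
  \<comment> \<open>On \<open>M\<close>, \<open>ln k\<close> is at least \<open>3/2 ln y - 2\<close>
    while \<open>ell y \<le> ln y + 6\<close>, so the weight is at least a third of
    \<open>ln k\<close>.\<close>
  also have "\<dots> \<le> (\<Sum>k\<in>M. 3 * ((ln (real k) + 9 - ell y) / real k))"
  proof (intro sum_mono)
    fix k assume "k \<in> M"
    then have k: "k > 0" and yk: "real y * sqrt (real y) \<le> 3 * real k"
      by (auto simp: M_def chain_le_pos)
    have "ln (real y * sqrt (real y)) \<le> ln (3 * real k)"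
      using k y yk by (subst ln_le_cancel_iff) auto
    then have "3 * ln (real y) / 2 \<le> ln 3 + ln (real k)"
      using k y by (simp add: ln_mult ln_sqrt)
    then have "ln (real k) \<le> 3 * (ln (real k) + 9 - ell y)"
      using ell_le[of y] y ln_3_le by simp
    then have "ln (real k) / real k \<le> 3 * (ln (real k) + 9 - ell y) / real k"
      using k by (intro divide_right_mono) auto
    then show "ln (real k) / real k \<le> 3 * ((ln (real k) + 9 - ell y) / real k)" by simp
  qed
  also have "\<dots> \<le> (\<Sum>k\<in>chain_le dense_step y (N * y). 3 * ((ln (real k) + 9 - ell y) / real k))"
  proof (intro sum_mono2)
    fix k assume "k \<in> chain_le dense_step y (N * y) - M"
    then have "k \<in> chain dense_step y" by (auto simp: chain_le_def)
    then show "0 \<le> 3 * ((ln (real k) + 9 - ell y) / real k)"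
      using ell_Suc_le_dense_chain[of k y] ell_mono_Suc[of y] by auto
  qed (auto simp: M_def)
  also have "\<dots> = 3 * (\<Sum>k\<in>chain_le dense_step y (N * y). (ln (real k) + 9 - ell y) / real k)"
    by (simp only: sum_distrib_left)
  also have "\<dots> \<le> 3 * (9 * euler_prod y)"
    by (intro mult_left_mono sum_height_dense_chain_le) auto
  finally show ?thesis by (simp add: A_def)
qed

lemma ln_Suc_le_double:
  assumes "y \<ge> 2"
  shows "ln (real y + 1) \<le> 2 * ln (real y)"
proof -
  have "real y + 1 \<le> real y * 2" using assms by simp
  also have "\<dots> \<le> real y * real y" using assms by (intro mult_left_mono) auto
  finally have "ln (real y + 1) \<le> ln (real y * real y)"
    using assms by (subst ln_le_cancel_iff) auto
  then show ?thesis using assms by (simp add: ln_mult)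
qed

text \<open>The preceding bound saves a factor \<open>ln y\<close> over the Euler product, which
  itself is only \<open>O(ln y)\<close>.\<close>

lemma sum_inverse_dense_chain_bounded:
  "\<exists>C>0::real. \<forall>y\<ge>1. \<forall>N. (\<Sum>m\<in>chain_le dense_step y N. 1 / real m) \<le> C"
proof -
  obtain C :: real where C: "C > 0" "\<And>y. y \<ge> 1 \<Longrightarrow> euler_prod y \<le> C * ln (real y + 1)"
    using euler_prod_upper by blast
  show ?thesis
  proof (intro exI[of _ "128 * C"] conjI allI impI)
    fix y N :: nat assume y: "y \<ge> 1"
    define A where "A = (\<Sum>m\<in>chain_le dense_step y N. 1 / real m)"
    have AE: "A \<le> euler_prod y" unfolding A_def by (rule sum_inverse_chain_le)
    show "A \<le> 128 * C"
    proof (cases "y = 1")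
      case True
      have "A \<le> C * ln 2" using AE C(2)[of 1] True by simp
      also have "\<dots> \<le> C * 1"
        using C(1) ln_le_minus_one[of "2::real"] by (intro mult_left_mono) auto
      finally show ?thesis using C(1) by simp
    next
      case False
      with y have y2: "y \<ge> 2" by simp
      have "A * (ln (real y) / 2 - 5) \<le> 27 * euler_prod y"
        unfolding A_def by (rule sum_inverse_dense_chain_aux[OF y])
      \<comment> \<open>The term \<open>5 * A\<close> is moved to the right by the trivial bound
        \<open>A \<le> euler_prod y\<close>, so small \<open>y\<close> need no separate treatment;
        \<open>64 = 2 * (27 + 5)\<close>.\<close>
      then have "A * ln (real y) \<le> 64 * euler_prod y"
        using AE by (simp add: algebra_simps)
      also have "\<dots> \<le> 64 * (C * ln (real y + 1))"
        using C(2)[OF y] by simp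
      also have "\<dots> \<le> 64 * (C * (2 * ln (real y)))"
        using C(1) ln_Suc_le_double[OF y2] by (intro mult_left_mono) auto
      finally show ?thesis using y2 by simp
    qed
  qed (use C in auto)
qed

text \<open>First moment: the weighted sum bounds \<open>ln m + 9 - ell y\<close>, and the missing
  \<open>ell y\<close> multiplies a bounded mass.\<close>

lemma sum_ln_dense_chain_le:
  "\<exists>C>0::real. \<forall>y\<ge>1. \<forall>N. (\<Sum>m\<in>chain_le dense_step y N. (ln (real m) + 9) / real m) \<le> C * ln (real y + 1)"
proof -
  obtain C :: real where C: "C > 0" "\<And>y. y \<ge> 1 \<Longrightarrow> euler_prod y \<le> C * ln (real y + 1)"
    using euler_prod_upper by blast
  obtain K :: real where K: "K > 0"
      "\<And>y N. y \<ge> 1 \<Longrightarrow> (\<Sum>m\<in>chain_le dense_step y N. 1 / real m) \<le> K"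
    using sum_inverse_dense_chain_bounded by blast
  have ln2: "ln (2::real) > 0" by simp
  define K' where "K' = 9 * C + (1 + 6 / ln 2) * K"
  show ?thesis
  proof (intro exI[of _ K'] conjI allI impI)
    show "K' > 0" using C(1) K(1) ln2 by (auto simp: K'_def intro!: add_pos_pos mult_pos_pos)
    fix y N :: nat assume y: "y \<ge> 1"
    define A where "A = (\<Sum>m\<in>chain_le dense_step y N. 1 / real m)"
    have "(\<Sum>m\<in>chain_le dense_step y N. (ln (real m) + 9) / real m) =
          (\<Sum>m\<in>chain_le dense_step y N. (ln (real m) + 9 - ell y) / real m) + ell y * A"
      unfolding A_def sum_distrib_left sum.distrib[symmetric]
      by (intro sum.cong refl) (simp add: diff_divide_distrib add_divide_distrib)
    also have "\<dots> \<le> 9 * euler_prod y + ell y * A"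
      by (intro add_mono sum_height_dense_chain_le) auto
    also have "ell y * A \<le> ell y * K"
      unfolding A_def using y by (intro mult_left_mono K ell_nonneg) auto
    also have "ell y * K \<le> ((1 + 6 / ln 2) * ln (real y + 1)) * K"
    proof (intro mult_right_mono)
      have "ell y \<le> ln (real y) + 6" using y by (intro ell_le) auto
      also have "ln (real y) \<le> ln (real y + 1)" using y by simp
      also have "6 \<le> 6 / ln 2 * ln (real y + 1)"
      proof -
        have "ln 2 \<le> ln (real y + 1)" using y by simp
        then have "6 / ln 2 * ln 2 \<le> 6 / ln 2 * ln (real y + 1)"
          using ln2 by (intro mult_left_mono) auto
        then show ?thesis by simp
      qed
      finally show "ell y \<le> (1 + 6 / ln 2) * ln (real y + 1)" by (simp add: distrib_right)
    qed (use K in auto)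
    also have "9 * euler_prod y \<le> 9 * (C * ln (real y + 1))"
      using C(2)[OF y] by simp
    finally show "(\<Sum>m\<in>chain_le dense_step y N. (ln (real m) + 9) / real m) \<le> K' * ln (real y + 1)"
      by (simp add: K'_def algebra_simps)
  qed
qed

text \<open>Second moment by induction over primes: the mass and first-moment bounds control what
  each prime adds, and \<open>ell\<close> accumulates these additions.\<close>

lemma sum_ln_square_dense_chain_le:
  "\<exists>C>0::real. \<forall>y\<ge>2. \<forall>N. (\<Sum>m\<in>chain_le dense_step y N. (ln (real m) + 9)^2 / real m) \<le> C * ln (real y) ^ 2"
proof -
  obtain C :: real where C: "C > 0" "\<And>y. y \<ge> 1 \<Longrightarrow> euler_prod y \<le> C * ln (real y + 1)"
    using euler_prod_upper by blast
  obtain K0 :: real where K0: "K0 > 0"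
      "\<And>y N. y \<ge> 1 \<Longrightarrow> (\<Sum>m\<in>chain_le dense_step y N. 1 / real m) \<le> K0"
    using sum_inverse_dense_chain_bounded by blast
  obtain K1 :: real where K1: "K1 > 0"
      "\<And>y N. y \<ge> 1 \<Longrightarrow> (\<Sum>m\<in>chain_le dense_step y N. (ln (real m) + 9) / real m) \<le> K1 * ln (real y + 1)"
    using sum_ln_dense_chain_le by blast
  define K where "K = 2 * K1 + 12 * K0"
  have K: "K > 0" using K0 K1 by (simp add: K_def)
  \<comment> \<open>The 81 is the value at \<open>m = 1\<close>; \<open>K\<close> collects the
    coefficients 2 and 12 of \<open>sum_prime_powers_square_le\<close>.\<close>
  have Q: "(\<Sum>m\<in>chain_le dense_step y N. (ln (real m) + 9)^2 / real m) \<le> euler_prod y * (81 + K * ell y)"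
    (is "?Q y \<le> _") for y N
  proof (induction y)
    case 0
    have "?Q 0 \<le> (\<Sum>m\<in>{1}. (ln (real m) + 9)^2 / real m)"
      by (intro sum_mono2 chain_le_0) auto
    then show ?case by simp
  next
    case (Suc y)
    show ?case
    proof (cases "prime (Suc y)")
      case True
      define p where "p = real (Suc y)"
      have p: "p \<ge> 2" using prime_ge_2_nat[OF True] by (simp add: p_def)
      have y1: "y \<ge> 1" using prime_ge_2_nat[OF True] by simp
      define L where "L = ln p"
      have L: "L \<ge> 0" using p by (simp add: L_def)
      have Ly: "ln (real y + 1) = L" by (simp add: L_def p_def add.commute)
      have ell: "ell (Suc y) = ell y + L / (p - 1)"
        using True by (simp add: ell_Suc p_def L_def)
      have pos: "ln (real a) + 9 \<ge> 0" if "a \<in> chain dense_step y" for a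
        using chain_pos[OF that] by (intro add_nonneg_nonneg) auto
      let ?f = "\<lambda>m. (ln (real m) + 9)^2 / real m"
      have f: "?f (a * Suc y ^ k) = ((ln (real a) + 9) + real k * L)^2 / (real a * p ^ k)"
        if "a \<in> chain dense_step y" for a k
        using chain_pos[OF that] p
        by (simp add: p_def[symmetric] L_def ln_mult ln_realpow add_ac del: of_nat_Suc)
      have "?Q (Suc y) \<le> (\<Sum>a\<in>chain_le dense_step y N. \<Sum>k\<le>N. ?f (a * Suc y ^ k))"
        by (intro sum_chain_Suc_prime True) auto
      also have "\<dots> \<le> (\<Sum>a\<in>chain_le dense_step y N. p / (p - 1) * (?f a
          + 2 * L / (p - 1) * ((ln (real a) + 9) / real a) + 12 * L^2 / (p - 1) * (1 / real a)))"
      proof (intro sum_mono)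
        fix a assume "a \<in> chain_le dense_step y N"
        then have a: "a \<in> chain dense_step y" by (simp add: chain_le_def)
        show "(\<Sum>k\<le>N. ?f (a * Suc y ^ k)) \<le> p / (p - 1) * (?f a
          + 2 * L / (p - 1) * ((ln (real a) + 9) / real a) + 12 * L^2 / (p - 1) * (1 / real a))"
          unfolding f[OF a] using p L chain_pos[OF a] pos[OF a]
          by (intro sum_prime_powers_square_le) auto
      qed
      also have "\<dots> = p / (p - 1) * (?Q y
          + 2 * L / (p - 1) * (\<Sum>a\<in>chain_le dense_step y N. (ln (real a) + 9) / real a)
          + 12 * L^2 / (p - 1) * (\<Sum>a\<in>chain_le dense_step y N. 1 / real a))"
        by (simp only: sum_distrib_left[symmetric] sum.distrib)
      also have "\<dots> \<le> p / (p - 1) * (euler_prod y * (81 + K * ell y)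
          + 2 * L / (p - 1) * (K1 * L) + 12 * L^2 / (p - 1) * K0)"
        using p L K1(2)[OF y1, of N] K0(2)[OF y1, of N] Suc unfolding Ly
        by (intro mult_left_mono add_mono) auto
      also have "\<dots> = p / (p - 1) * (euler_prod y * (81 + K * ell y) + L * (K * L / (p - 1)))"
        by (simp add: K_def power2_eq_square add_divide_distrib algebra_simps)
      \<comment> \<open>The spare factor \<open>L = ln (y + 1)\<close> is at most
        \<open>euler_prod y\<close>, so the addition becomes \<open>euler_prod y\<close> times
        \<open>K\<close> times the increment of \<open>ell\<close>.\<close>
      also have "\<dots> \<le> p / (p - 1) * (euler_prod y * (81 + K * ell y) + euler_prod y * (K * L / (p - 1)))"
        using p L K euler_prod_lower[of y] unfolding Ly
        by (intro mult_left_mono add_left_mono mult_right_mono divide_nonneg_nonneg) auto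
      also have "\<dots> = (euler_prod y * (p / (p - 1))) * (81 + K * ell (Suc y))"
        by (simp add: ell algebra_simps)
      also have "euler_prod y * (p / (p - 1)) = euler_prod (Suc y)"
        using True by (simp add: euler_prod_Suc p_def)
      finally show ?thesis .
    next
      case False
      have "?Q (Suc y) \<le> ?Q y"
        by (intro sum_chain_Suc_not_prime False) auto
      with Suc False show ?thesis by (simp add: ell_Suc euler_prod_Suc)
    qed
  qed
  have ln2: "ln (2::real) > 0" by simp
  define K' where "K' = 2 * C * ((81 + 6 * K) / ln 2 + K)"
  show ?thesis
  proof (intro exI[of _ K'] conjI allI impI)
    show "K' > 0" using C(1) K ln2 by (auto simp: K'_def intro!: add_pos_pos mult_pos_pos)
    fix y N :: nat assume y: "y \<ge> 2"
    have lny: "ln 2 \<le> ln (real y)" using y by simp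
    have "euler_prod y \<le> C * ln (real y + 1)" using y by (intro C) auto
    also have "\<dots> \<le> C * (2 * ln (real y))"
      using C(1) by (intro mult_left_mono ln_Suc_le_double y) auto
    finally have "euler_prod y \<le> 2 * C * ln (real y)" by simp
    moreover have "81 + K * ell y \<le> ((81 + 6 * K) / ln 2 + K) * ln (real y)"
    proof -
      have "K * ell y \<le> K * (ln (real y) + 6)"
        using y K by (intro mult_left_mono ell_le) auto
      moreover have "(81 + 6 * K) / ln 2 * ln 2 \<le> (81 + 6 * K) / ln 2 * ln (real y)"
        using lny K ln2 by (intro mult_left_mono divide_nonneg_nonneg) auto
      then have "81 + 6 * K \<le> (81 + 6 * K) / ln 2 * ln (real y)" by simp
      ultimately show ?thesis unfolding distrib_left distrib_right by linarith
    qed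
    ultimately have "euler_prod y * (81 + K * ell y) \<le>
        (2 * C * ln (real y)) * (((81 + 6 * K) / ln 2 + K) * ln (real y))"
      using C(1) K lny ln2 ell_nonneg[of y] euler_prod_pos[of y]
      by (intro mult_mono) (auto intro!: mult_nonneg_nonneg add_nonneg_nonneg)
    also have "\<dots> = K' * ln (real y) ^ 2"
      by (simp add: K'_def power2_eq_square)
    finally show "(\<Sum>m\<in>chain_le dense_step y N. (ln (real m) + 9)^2 / real m) \<le> K' * ln (real y) ^ 2"
      using Q[where y = y and N = N] by linarith
  qed
qed

section \<open>Rough numbers\<close>

definition rough :: "nat \<Rightarrow> nat \<Rightarrow> nat set" where
  "rough p N = {r \<in> {1..N}. \<forall>q. prime q \<longrightarrow> q dvd r \<longrightarrow> p \<le> q}"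

lemma finite_rough [simp]: "finite (rough p N)"
  by (simp add: rough_def)

lemma coprime_rough_less:
  assumes "r \<in> rough p N" "m > 0" "m < p"
  shows "coprime r m"
proof (rule ccontr)
  assume "\<not> coprime r m"
  then obtain q where q: "prime q" "q dvd gcd r m"
    using prime_factor_nat[of "gcd r m"] coprime_iff_gcd_eq_1 by blast
  then have "p \<le> q" "q \<le> m"
    using assms by (auto simp: rough_def intro: dvd_imp_le)
  then show False using assms by simp
qed

text \<open>Every \<open>m < p\<close> is coprime to every \<open>p\<close>-rough number, so the products \<open>r * m\<close> are distinct.\<close>
lemma sum_inverse_rough_le:
  assumes "p \<ge> 2" "p \<le> N"
  shows "(\<Sum>r\<in>rough p N. 1 / real r) * ln (real p) \<le> 4 * ln (real N)"
proof -
  have "ln (real p) \<le> (\<Sum>m=1..p-1. 1 / real m)"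
    using ln_le_sum_inverse[of "p - 1"] assms by (simp add: of_nat_diff)
  then have "(\<Sum>r\<in>rough p N. 1 / real r) * ln (real p) \<le>
        (\<Sum>r\<in>rough p N. 1 / real r) * (\<Sum>m=1..p-1. 1 / real m)"
    by (intro mult_left_mono sum_nonneg) auto
  also have "\<dots> = (\<Sum>(r,m)\<in>rough p N \<times> {1..p-1}. 1 / real (r * m))"
    by (simp add: sum_product sum.cartesian_product)
  also have "\<dots> = (\<Sum>k\<in>(\<lambda>(r,m). r * m) ` (rough p N \<times> {1..p-1}). 1 / real k)"
  proof (subst sum.reindex)
    show "inj_on (\<lambda>(r,m). r * m) (rough p N \<times> {1..p-1})"
    proof (rule inj_onI, clarify)
      fix r m r' m' assume *: "r \<in> rough p N" "m \<in> {1..p-1}" "r' \<in> rough p N" "m' \<in> {1..p-1}"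
        and eq: "r * m = r' * m'"
      have "coprime r m'" "coprime r' m" using * by (auto intro!: coprime_rough_less)
      then have "r dvd r'" "r' dvd r"
        using eq by (metis coprime_dvd_mult_left_iff dvd_triv_left)+
      then have "r = r'" by (rule dvd_antisym)
      moreover have "r > 0" using *(1) by (auto simp: rough_def)
      ultimately show "r = r' \<and> m = m'" using eq by simp
    qed
  qed (auto simp: split_def)
  also have "\<dots> \<le> (\<Sum>k=1..N*p. 1 / real k)"
  proof (intro sum_mono2)
    show "(\<lambda>(r,m). r * m) ` (rough p N \<times> {1..p-1}) \<subseteq> {1..N*p}"
    proof clarify
      fix r m assume "r \<in> rough p N" "m \<in> {1..p-1}"
      then have "r \<ge> 1" "r \<le> N" "m \<ge> 1" "m \<le> p" by (auto simp: rough_def)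
      then have "1 * 1 \<le> r * m" "r * m \<le> N * p" by (intro mult_le_mono; simp)+
      then show "r * m \<in> {1..N*p}" by simp
    qed
  qed auto
  also have "\<dots> \<le> 1 + ln (real (N * p))"
    using assms by (intro sum_inverse_le_ln) auto
  also have "\<dots> = 1 + ln (real N) + ln (real p)"
    using assms by (simp add: ln_mult)
  also have "ln (real p) \<le> ln (real N)" using assms by simp
  also have "1 \<le> 2 * ln (real N)"
  proof -
    have "1 / 2 \<le> ln (2::real)" using ln_le_minus_one[of "1/2::real"] by (simp add: ln_div)
    also have "ln 2 \<le> ln (real N)" using assms by simp
    finally show ?thesis by simp
  qed
  finally show ?thesis by simp
qed

text \<open>Weighting by logarithms: writing \<open>ln r\<close> as a \<open>mangoldt\<close> sum
  over \<open>r = s * d\<close> and applying Chebyshev to \<open>d\<close> bounds the count times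
  \<open>ln N\<close> by \<open>5 N\<close> times the reciprocal sum over rough numbers, which is at
  most \<open>4 ln N / ln p\<close>.\<close>

lemma card_rough_le:
  assumes "p \<ge> 2" "p \<le> N"
  shows "real (card (rough p N)) * ln (real p) \<le> 20 * real N"
proof -
  let ?R = "rough p N"
  let ?S = "\<Sum>r\<in>?R. 1 / real r"
  have lnN: "ln (real N) > 0" using assms by simp
  have pos: "r > 0" if "r \<in> ?R" for r using that by (auto simp: rough_def)
  have "(\<Sum>r\<in>?R. ln (real r)) = (\<Sum>r\<in>?R. \<Sum>d | d dvd r. mangoldt d)"
    by (intro sum.cong refl) (use mangoldt_sum[where ?'a = real] pos in auto)
  also have "\<dots> = (\<Sum>(r,d)\<in>(SIGMA r:?R. {d. d dvd r}). mangoldt d)"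
    by (subst sum.Sigma) (auto intro!: finite_divisors_nat pos)
  also have "\<dots> = (\<Sum>(s,d)\<in>(\<lambda>(r,d). (r div d, d)) ` (SIGMA r:?R. {d. d dvd r}). mangoldt d)"
  proof (subst sum.reindex)
    show "inj_on (\<lambda>(r,d). (r div d, d)) (SIGMA r:?R. {d. d dvd r})"
      by (auto simp: inj_on_def) (metis dvd_div_mult_self)
  qed (auto simp: split_def)
  \<comment> \<open>The cofactor \<open>s\<close> stays rough, while roughness of \<open>d\<close>
    is given up.\<close>
  also have "\<dots> \<le> (\<Sum>(s,d)\<in>(SIGMA s:?R. {1..N div s}). mangoldt d)"
  proof (intro sum_mono2)
    show "(\<lambda>(r,d). (r div d, d)) ` (SIGMA r:?R. {d. d dvd r}) \<subseteq> (SIGMA s:?R. {1..N div s})"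
    proof clarify
      fix r d assume r: "r \<in> ?R" and "d dvd r"
      then obtain s where s: "r = d * s" by auto
      have sd: "s > 0" "d > 0" using pos[OF r] s by auto
      have "s \<in> ?R" using r s sd
        by (auto simp: rough_def Suc_le_eq intro: order.trans[of s "d * s" N])
      moreover have "d \<le> N div s"
        using r s sd by (simp add: rough_def less_eq_div_iff_mult_less_eq)
      ultimately show "r div d \<in> ?R \<and> d \<in> {1..N div (r div d)}" using s sd by simp
    qed
  qed (auto simp: mangoldt_nonneg)
  also have "\<dots> = (\<Sum>s\<in>?R. psi (N div s))"
    unfolding psi_def by (subst sum.Sigma) auto
  also have "\<dots> \<le> (\<Sum>s\<in>?R. 4 * (real N / real s))"
  proof (intro sum_mono)
    fix s
    have "psi (N div s) \<le> 4 * real (N div s)" by (rule psi_le)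
    also have "\<dots> \<le> 4 * (real N / real s)"
      by (intro mult_left_mono of_nat_div_le_of_nat) auto
    finally show "psi (N div s) \<le> 4 * (real N / real s)" .
  qed
  also have "\<dots> = 4 * real N * ?S" by (simp add: sum_distrib_left)
  finally have 1: "(\<Sum>r\<in>?R. ln (real r)) \<le> 4 * real N * ?S" .
  have "(\<Sum>r\<in>?R. ln (real N) - ln (real r)) \<le> (\<Sum>r\<in>?R. real N * (1 / real r))"
  proof (intro sum_mono)
    fix r assume "r \<in> ?R"
    then have "r > 0" by (rule pos)
    then have "ln (real N) - ln (real r) = ln (real N / real r)"
      using assms by (simp add: ln_div)
    also have "\<dots> \<le> real N / real r - 1"
      using assms \<open>r > 0\<close> by (intro ln_le_minus_one) auto
    finally show "ln (real N) - ln (real r) \<le> real N * (1 / real r)" by simp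
  qed
  also have "\<dots> = real N * ?S" by (simp only: sum_distrib_left)
  finally have 2: "real (card ?R) * ln (real N) - (\<Sum>r\<in>?R. ln (real r)) \<le> real N * ?S"
    by (simp add: sum_subtractf)
  have "real (card ?R) * ln (real N) \<le> 5 * real N * ?S"
    using 1 2 by (simp add: algebra_simps)
  then have "real (card ?R) * ln (real N) * ln (real p) \<le> 5 * real N * ?S * ln (real p)"
    using assms by (intro mult_right_mono) auto
  also have "\<dots> = 5 * real N * (?S * ln (real p))" by simp
  also have "\<dots> \<le> 5 * real N * (4 * ln (real N))"
    by (intro mult_left_mono sum_inverse_rough_le assms) auto
  finally have "(real (card ?R) * ln (real p)) * ln (real N) \<le> (20 * real N) * ln (real N)"
    by (simp add: mult_ac)
  then show ?thesis using lnN by simp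
qed

section \<open>Practical numbers\<close>

text \<open>For odd \<open>q\<close>, \<open>q - 1\<close> divides the value at the full power of
  \<open>q\<close> in \<open>d\<close>, hence the lcm; for \<open>q = 2\<close> positivity
  suffices.\<close>

lemma Carmichael_ge_prime_minus_1:
  assumes "prime q" "q dvd d" "d > 0"
  shows "q - 1 \<le> Carmichael d"
proof (cases "q = 2")
  case True
  then show ?thesis using Carmichael_pos[of d] by (simp add: Suc_le_eq del: Carmichael_pos)
next
  case False
  then have "odd q" using assms(1) primes_dvd_imp_eq two_is_prime_nat by blast
  have "\<not> is_unit q" using assms(1) by auto
  then obtain e where e: "d = q ^ multiplicity q d * e" "\<not> q dvd e"
    using multiplicity_decompose'[of d q] assms(3) by auto
  have k: "multiplicity q d > 0"
    using assms by (simp add: prime_multiplicity_gt_zero_iff)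
  have "coprime (q ^ multiplicity q d) e"
    using assms(1) e(2) by (simp add: prime_imp_coprime_nat)
  then have "Carmichael d = lcm (Carmichael (q ^ multiplicity q d)) (Carmichael e)"
    using e(1) Carmichael_mult_coprime by metis
  also have "Carmichael (q ^ multiplicity q d) = q ^ (multiplicity q d - 1) * (q - 1)"
    using assms(1) \<open>odd q\<close> k by (intro Carmichael_odd_prime_power)
  finally have "q - 1 dvd Carmichael d" by (simp add: dvd_lcmI1)
  then show ?thesis by (intro dvd_imp_le) auto
qed

lemma sum_Carmichael_divisors_le: "(\<Sum>d | d dvd n. Carmichael d) \<le> n" if "n > 0"
proof -
  have "(\<Sum>d | d dvd n. Carmichael d) \<le> (\<Sum>d | d dvd n. totient d)"
  proof (intro sum_mono dvd_imp_le Carmichael_dvd_totient)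
    fix d assume "d \<in> {d. d dvd n}"
    then have "d > 0" using that by (auto intro: Nat.gr0I)
    then show "totient d > 0" by simp
  qed
  then show ?thesis by (simp add: totient_divisor_sum)
qed

text \<open>Let \<open>p\<close> be the least prime divisor of \<open>n\<close> above
  \<open>z\<close>. In a representation of \<open>p - 2\<close>, a divisor with a prime factor above
  \<open>z\<close> would contribute at least \<open>p - 1\<close>, so only divisors of the
  \<open>z\<close>-smooth part occur.\<close>

lemma practical_spart_ge:
  assumes n: "lambda_star_practical n" and q: "prime q" "q dvd n" "z < q"
  shows "z \<le> spart z n + 1"
proof -
  have n0: "n > 0" using n by (simp add: lambda_star_practical_def)
  define P where "P p \<longleftrightarrow> prime p \<and> p dvd n \<and> z < p" for p
  define p where "p = (LEAST p. P p)"
  have "P q" using q by (simp add: P_def)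
  then have p: "P p" unfolding p_def by (rule LeastI)
  have least: "p \<le> r" if "P r" for r unfolding p_def using that by (rule Least_le)
  have p2: "p \<ge> 2" using p by (auto simp: P_def dest: prime_ge_2_nat)
  show ?thesis
  \<comment> \<open>Here \<open>p - 2\<close> is 0, outside the range of representable targets, but
    \<open>z \<le> 1\<close>.\<close>
  proof (cases "p = 2")
    case True
    then show ?thesis using p by (simp add: P_def)
  next
    case False
    have "p - 2 \<le> Carmichael p"
      using Carmichael_ge_prime_minus_1[of p p] p p2 by (simp add: P_def)
    also have "\<dots> \<le> (\<Sum>d | d dvd n. Carmichael d)"
      using p n0 by (intro member_le_sum) (auto simp: P_def)
    finally obtain D where D: "D \<subseteq> {d. d dvd n}" "p - 2 = (\<Sum>d\<in>D. Carmichael d)"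
      using n p2 False unfolding lambda_star_practical_def by (metis le_neq_implies_less zero_less_diff)
    have finD: "finite D" using D(1) n0 finite_divisors_nat finite_subset by blast
    have "D \<subseteq> {d. d dvd spart z n}"
    proof
      fix d assume d: "d \<in> D"
      then have d0: "d dvd n" "d > 0" using D n0 by (auto intro: Nat.gr0I)
      have "d dvd spart z n"
      proof (rule dvd_spartI[OF d0(2) n0 d0(1)])
        fix r assume r: "prime r" "r dvd d"
        show "r \<le> z"
        proof (rule ccontr)
          assume "\<not> r \<le> z"
          then have "P r" using r d0 by (auto simp: P_def)
          then have "p - 1 \<le> r - 1" using least by (intro diff_le_mono)
          also have "\<dots> \<le> Carmichael d" using r d0 by (intro Carmichael_ge_prime_minus_1)
          also have "\<dots> \<le> (\<Sum>d\<in>D. Carmichael d)" using d finD by (intro member_le_sum) auto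
          also have "\<dots> = p - 2" using D by simp
          finally show False using p2 by simp
        qed
      qed
      then show "d \<in> {d. d dvd spart z n}" by simp
    qed
    then have "(\<Sum>d\<in>D. Carmichael d) \<le> (\<Sum>d | d dvd spart z n. Carmichael d)"
      using spart_pos[of z n] by (intro sum_mono2) auto
    also have "\<dots> \<le> spart z n" by (intro sum_Carmichael_divisors_le spart_pos)
    finally have "p - 2 \<le> spart z n" using D by simp
    moreover have "z < p" using p by (simp add: P_def)
    ultimately show ?thesis by linarith
  qed
qed

text \<open>Multiply the prime factors of \<open>n\<close> in increasing order: \<open>m\<close> is
  the last partial product not exceeding \<open>T\<close> and \<open>p\<close> the next prime
  factor.\<close>

lemma practical_decomposition:
  assumes n: "lambda_star_practical n" and T: "1 \<le> T" "T < n"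
  obtains p m r where "prime p" "m \<in> chain dense_step p" "m \<le> T" "T < m * p"
    "n = m * p * r" "r > 0" "\<And>q. prime q \<Longrightarrow> q dvd r \<Longrightarrow> p \<le> q"
proof -
  have n0: "n > 0" using T by simp
  define y where "y = (LEAST y. T < spart y n)"
  have "T < spart n n" using T spart_eq_self[of n n] by simp
  then have y: "T < spart y n" unfolding y_def by (rule LeastI)
  have y_min: "spart z n \<le> T" if "z < y" for z
    using not_less_Least[of z "\<lambda>y. T < spart y n"] that unfolding y_def by simp
  have "y \<noteq> 0" using y T by (intro notI) simp
  then obtain w where w: "y = Suc w" by (cases y) auto
  have prime: "prime y"
  proof (rule ccontr)
    assume "\<not> prime y"
    then have "spart y n = spart w n" by (simp add: w spart_Suc)
    then show False using y y_min[of w] w by simp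
  qed
  define m0 where "m0 = spart w n"
  define a where "a = multiplicity y n"
  have m0: "m0 \<le> T" "m0 > 0" using y_min[of w] by (auto simp: w m0_def spart_pos)
  have sp: "spart y n = m0 * y ^ a" using prime by (simp add: w spart_Suc m0_def a_def)
  \<comment> \<open>The threshold may be crossed inside the power of \<open>y\<close>, so only
    \<open>b\<close> of the \<open>a\<close> copies are used so far.\<close>
  define b where "b = (LEAST b. T < m0 * y ^ b)"
  have "T < m0 * y ^ a" using y sp by simp
  then have b: "T < m0 * y ^ b" and ba: "b \<le> a"
    unfolding b_def by (rule LeastI, rule Least_le)
  have "b \<noteq> 0" using b m0 by (intro notI) simp
  then obtain c where c: "b = Suc c" by (cases b) auto
  define m where "m = m0 * y ^ c"
  have mT: "m \<le> T"
    using not_less_Least[of c "\<lambda>b. T < m0 * y ^ b"] c unfolding b_def m_def by simp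
  have "multiplicity y n > 0" using ba c by (simp add: a_def)
  then have ydvd: "y dvd n" using not_dvd_imp_multiplicity_0[of y n] by auto
  have gap: "z \<le> spart z n + 1" if "z < y" for z
    by (rule practical_spart_ge[OF n prime ydvd that])
  have "m0 \<in> chain dense_step w"
    unfolding m0_def
  proof (rule spart_in_chain)
    fix z assume "z \<le> w"
    then show "dense_step z (spart z n)" using gap[of z] by (simp add: w dense_step_def)
  qed
  moreover have "dense_step y m"
  proof -
    have "w \<le> m0 + 1" using gap[of w] by (simp add: w m0_def)
    moreover have "m0 * 1 \<le> m" unfolding m_def using w by (intro mult_le_mono) auto
    ultimately show ?thesis by (simp add: dense_step_def w)
  qed
  ultimately have chain: "m \<in> chain dense_step y"
    using prime unfolding m_def w by auto
  have mb: "m * y = m0 * y ^ b" by (simp add: m_def c)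
  have "m * y dvd spart y n" unfolding mb sp using ba by (intro mult_dvd_mono le_imp_power_dvd) auto
  also have "\<dots> dvd n" by (rule spart_dvd[OF n0])
  finally obtain r where r: "n = m * y * r" by auto
  \<comment> \<open>All copies of primes below \<open>y\<close> are already in \<open>m0\<close>, so
    another one in \<open>r\<close> would exceed the multiplicity in \<open>n\<close>.\<close>
  have rough: "y \<le> q" if q: "prime q" "q dvd r" for q
  proof (rule ccontr)
    assume "\<not> y \<le> q"
    then have "q \<le> w" by (simp add: w)
    then have "multiplicity q m0 = multiplicity q n"
      using q by (simp add: m0_def multiplicity_spart)
    moreover have "m0 * q dvd n"
      unfolding r m_def using q(2) by (intro mult_dvd_mono) (auto intro: mult_dvd_mono)
    then have "multiplicity q (m0 * q) \<le> multiplicity q n"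
      using n0 by (intro dvd_imp_multiplicity_le) auto
    moreover have "multiplicity q (m0 * q) = multiplicity q m0 + 1"
      using q m0 by (subst prime_elem_multiplicity_mult_distrib) (auto dest: prime_gt_0_nat)
    ultimately show False by simp
  qed
  have "r > 0" using r n0 by (auto intro: Nat.gr0I)
  then show ?thesis
    using that[OF prime chain _ _ r _ rough] mT b[folded mb] by simp
qed

text \<open>Numbers up to \<open>T\<close> are counted trivially, the others through their
  decomposition; \<open>p \<le> 3 * m\<close> and \<open>m \<le> T\<close> limit \<open>p\<close> to
  \<open>3 * T\<close>.\<close>

lemma card_practical_le:
  assumes T: "1 \<le> T"
  shows "card {n. 1 \<le> n \<and> n \<le> N \<and> lambda_star_practical n} \<le>
     T + (\<Sum>p | prime p \<and> p \<le> 3 * T. \<Sum>m | m \<in> chain_le dense_step p T \<and> T < m * p.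
            card (rough p (N div (m * p))))"
proof -
  let ?I = "\<lambda>p. {m. m \<in> chain_le dense_step p T \<and> T < m * p}"
  let ?J = "{p. prime p \<and> p \<le> 3 * T}"
  have sub: "{n. 1 \<le> n \<and> n \<le> N \<and> lambda_star_practical n} \<subseteq>
    {1..T} \<union> (\<Union>p\<in>?J. \<Union>m\<in>?I p. (\<lambda>r. m * p * r) ` rough p (N div (m * p)))"
  proof
    fix n assume "n \<in> {n. 1 \<le> n \<and> n \<le> N \<and> lambda_star_practical n}"
    then have n: "1 \<le> n" "n \<le> N" "lambda_star_practical n" by auto
    show "n \<in> {1..T} \<union> (\<Union>p\<in>?J. \<Union>m\<in>?I p. (\<lambda>r. m * p * r) ` rough p (N div (m * p)))"
    proof (cases "n \<le> T")
      case False
      then obtain p m r where pmr: "prime p" "m \<in> chain dense_step p" "m \<le> T" "T < m * p"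
        "n = m * p * r" "r > 0" "\<And>q. prime q \<Longrightarrow> q dvd r \<Longrightarrow> p \<le> q"
        using practical_decomposition[OF n(3) T, of thesis for thesis] by (metis not_le)
      have "p \<le> 3 * T" using dense_chain_lower(2)[OF pmr(2)] pmr(3) by simp
      moreover have "m * p > 0" using pmr(4) by linarith
      then have "r \<in> rough p (N div (m * p))"
        using pmr n(2) by (auto simp: rough_def less_eq_div_iff_mult_less_eq mult_ac)
      ultimately show ?thesis using pmr by (auto simp: chain_le_def)
    qed (use n in auto)
  qed
  have fin: "finite (?I p)" for p
    by (rule finite_subset[of _ "chain_le dense_step p T"]) auto
  have finJ: "finite ?J" by (rule finite_subset[of _ "{..3 * T}"]) auto
  have "card {n. 1 \<le> n \<and> n \<le> N \<and> lambda_star_practical n} \<le>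
    card ({1..T} \<union> (\<Union>p\<in>?J. \<Union>m\<in>?I p. (\<lambda>r. m * p * r) ` rough p (N div (m * p))))"
    using sub fin finJ by (intro card_mono) auto
  also have "\<dots> \<le> card {1..T} + card (\<Union>p\<in>?J. \<Union>m\<in>?I p. (\<lambda>r. m * p * r) ` rough p (N div (m * p)))"
    by (rule card_Un_le)
  also have "card (\<Union>p\<in>?J. \<Union>m\<in>?I p. (\<lambda>r. m * p * r) ` rough p (N div (m * p))) \<le>
     (\<Sum>p\<in>?J. \<Sum>m\<in>?I p. card (rough p (N div (m * p))))"
    using fin finJ
    by (intro order.trans[OF card_UN_le] sum_mono card_image_le) auto
  finally show ?thesis by simp
qed

lemma card_practical_le_div_ln:
  "\<exists>C>0::real. \<forall>T\<ge>9. \<forall>N\<ge>T^4.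
     real (card {n. 1 \<le> n \<and> n \<le> N \<and> lambda_star_practical n}) \<le> real T + C * real N / ln (real T)"
proof -
  obtain C :: real where C: "C > 0" "\<And>y N. y \<ge> 2 \<Longrightarrow>
      (\<Sum>m\<in>chain_le dense_step y N. (ln (real m) + 9)^2 / real m) \<le> C * ln (real y) ^ 2"
    using sum_ln_square_dense_chain_le by blast
  show ?thesis
  proof (intro exI[of _ "320 * C"] conjI allI impI)
    show "320 * C > 0" using C by simp
    fix T N :: nat assume T: "T \<ge> 9" and N: "N \<ge> T^4"
    let ?I = "\<lambda>p. {m. m \<in> chain_le dense_step p T \<and> T < m * p}"
    let ?J = "{p. prime p \<and> p \<le> 3 * T}"
    have lnT: "ln (real T) \<ge> 2"
    proof -
      have "exp 1 * exp 1 \<le> (3 * 3 :: real)"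
        using exp_le by (intro mult_mono) auto
      then have "exp 2 \<le> (9::real)" by (simp add: exp_add[symmetric])
      also have "9 \<le> real T" using T by simp
      finally show ?thesis using T by (subst ln_ge_iff) auto
    qed
    have inner: "(\<Sum>m\<in>?I p. real (card (rough p (N div (m * p))))) \<le>
        80 * C * real N / ln (real T)^2 * (ln (real p) / real p)" if "p \<in> ?J" for p
    proof -
      have p: "prime p" "p \<ge> 2" "p \<le> 3 * T" using that by (auto dest: prime_ge_2_nat)
      have lnp: "ln (real p) > 0" using p by simp
      have "(\<Sum>m\<in>?I p. real (card (rough p (N div (m * p))))) \<le>
          (\<Sum>m\<in>?I p. 20 * real N / (real p * ln (real p)) * (4 / ln (real T)^2 * ((ln (real m) + 9)^2 / real m)))"
      proof (intro sum_mono)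
        fix m assume "m \<in> ?I p"
        then have m: "m > 0" "m \<le> T" "T < m * p" "p \<le> 3 * m"
          using dense_chain_lower(2) by (auto simp: chain_le_def chain_pos)
        \<comment> \<open>This is why \<open>N \<ge> T^4\<close> and \<open>T \<ge> 9\<close> are
          assumed: the sieve bound needs \<open>p \<le> N div (m * p)\<close>.\<close>
        have "m * p * p \<le> T * (3 * T) * (3 * T)"
          using m p by (intro mult_le_mono) auto
        also have "\<dots> = 9 * T^3" by (simp add: power3_eq_cube)
        also have "\<dots> \<le> T * T^3" using T by (intro mult_le_mono) auto
        also have "\<dots> = T^4" by (simp flip: power_Suc)
        finally have "p * (m * p) \<le> N" using N by (simp add: mult_ac)
        then have "p \<le> N div (m * p)"
          using m p by (simp add: less_eq_div_iff_mult_less_eq)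
        then have "real (card (rough p (N div (m * p)))) * ln (real p) \<le> 20 * real (N div (m * p))"
          using p by (intro card_rough_le)
        also have "\<dots> \<le> 20 * (real N / real (m * p))"
          by (intro mult_left_mono of_nat_div_le_of_nat) auto
        finally have "real (card (rough p (N div (m * p)))) \<le> 20 * (real N / real (m * p)) / ln (real p)"
          unfolding pos_le_divide_eq[OF lnp] .
        also have "\<dots> = 20 * real N / (real p * ln (real p)) * (1 * (1 / real m))"
          by (simp add: mult_ac)
        \<comment> \<open>From \<open>T < m * p \<le> 3 * m^2\<close> the inserted factor is at
          least 1; it brings in \<open>1 / (ln T)^2\<close> and turns the sum over \<open>m\<close>
          into the second moment.\<close>
        also have "\<dots> \<le> 20 * real N / (real p * ln (real p)) * ((4 / ln (real T)^2 * (ln (real m) + 9)^2) * (1 / real m))"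
        proof (intro mult_left_mono mult_right_mono)
          have "real T \<le> real m * real p" using m(3) by (simp flip: of_nat_mult)
          also have "\<dots> \<le> real m * (3 * real m)" using m(4) by (intro mult_left_mono) linarith+
          finally have "ln (real T) \<le> ln (real m * (3 * real m))"
            using T m by (subst ln_le_cancel_iff) auto
          then have "ln (real T) \<le> 2 * ln (real m) + ln 3"
            using m by (simp add: ln_mult)
          then have "ln (real T) \<le> 2 * (ln (real m) + 9)" using ln_3_le by simp
          then have "ln (real T)^2 \<le> (2 * (ln (real m) + 9))^2" using lnT by (intro power_mono) auto
          then have "ln (real T)^2 \<le> 4 * (ln (real m) + 9)^2" unfolding power_mult_distrib by simp
          then show "1 \<le> 4 / ln (real T)^2 * (ln (real m) + 9)^2"
            using lnT by (simp add: field_simps)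
        qed (use lnp in auto)
        finally show "real (card (rough p (N div (m * p)))) \<le>
          20 * real N / (real p * ln (real p)) * (4 / ln (real T)^2 * ((ln (real m) + 9)^2 / real m))"
          by simp
      qed
      also have "\<dots> = 20 * real N / (real p * ln (real p)) * (4 / ln (real T)^2 *
           (\<Sum>m\<in>?I p. (ln (real m) + 9)^2 / real m))"
        by (simp only: sum_distrib_left)
      also have "\<dots> \<le> 20 * real N / (real p * ln (real p)) * (4 / ln (real T)^2 * (C * ln (real p)^2))"
      proof (intro mult_left_mono)
        have "(\<Sum>m\<in>?I p. (ln (real m) + 9)^2 / real m) \<le>
              (\<Sum>m\<in>chain_le dense_step p T. (ln (real m) + 9)^2 / real m)"
          by (intro sum_mono2) auto
        also have "\<dots> \<le> C * ln (real p)^2" by (rule C(2)[OF p(2)])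
        finally show "(\<Sum>m\<in>?I p. (ln (real m) + 9)^2 / real m) \<le> C * ln (real p)^2" .
      qed (use lnp in auto)
      also have "\<dots> = 80 * C * real N / ln (real T)^2 * (ln (real p) / real p)"
        using lnp by (simp add: power2_eq_square mult_ac)
      finally show ?thesis .
    qed
    have "real (card {n. 1 \<le> n \<and> n \<le> N \<and> lambda_star_practical n}) \<le>
        real (T + (\<Sum>p\<in>?J. \<Sum>m\<in>?I p. card (rough p (N div (m * p)))))"
      using T by (intro of_nat_mono card_practical_le) auto
    also have "\<dots> = real T + (\<Sum>p\<in>?J. \<Sum>m\<in>?I p. real (card (rough p (N div (m * p)))))"
      by simp
    also have "\<dots> \<le> real T + (\<Sum>p\<in>?J. 80 * C * real N / ln (real T)^2 * (ln (real p) / real p))"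
      by (intro add_left_mono sum_mono inner)
    also have "\<dots> = real T + 80 * C * real N / ln (real T)^2 * (\<Sum>p\<in>?J. ln (real p) / real p)"
      by (simp only: sum_distrib_left)
    \<comment> \<open>Mertens gives at most \<open>ln T + 6\<close>, and
      \<open>ln T \<ge> 2\<close>; one of the two saved logarithms is spent here.\<close>
    also have "\<dots> \<le> real T + 80 * C * real N / ln (real T)^2 * (4 * ln (real T))"
    proof (intro add_left_mono mult_left_mono)
      have "(\<Sum>p\<in>?J. ln (real p) / real p) \<le> ln (real (3 * T)) + 4"
        using T by (intro sum_ln_over_primes_le) auto
      also have "ln (real (3 * T)) = ln 3 + ln (real T)" using T by (simp add: ln_mult)
      finally show "(\<Sum>p\<in>?J. ln (real p) / real p) \<le> 4 * ln (real T)"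
        using ln_3_le lnT by linarith
    qed (use C in auto)
    also have "\<dots> = real T + 320 * C * real N / ln (real T)"
      using lnT by (simp add: power2_eq_square)
    finally show "real (card {n. 1 \<le> n \<and> n \<le> N \<and> lambda_star_practical n}) \<le>
        real T + 320 * C * real N / ln (real T)" .
  qed
qed

theorem theorem5p7:
  shows "\<exists>u::real. u > 0 \<and> (\<forall>X::real. X \<ge> 2 \<longrightarrow>
     real (card {n::nat. 1 \<le> n \<and> real n \<le> X \<and> lambda_star_practical n})
       \<le> u * X / ln X)"
proof -
  obtain C :: real where C: "C > 0" "\<And>T N. T \<ge> 9 \<Longrightarrow> N \<ge> T^4 \<Longrightarrow>
     real (card {n. 1 \<le> n \<and> n \<le> N \<and> lambda_star_practical n}) \<le> real T + C * real N / ln (real T)"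
    using card_practical_le_div_ln by blast
  \<comment> \<open>The first term handles \<open>X \<le> 10000\<close> by the trivial count; for
    larger \<open>X\<close> the 8 absorbs \<open>T\<close> and \<open>8 * C\<close> the main
    term.\<close>
  define u where "u = ln 10000 + 8 + 8 * C"
  have "ln (10000::real) \<ge> 0" by simp
  then have u: "u \<ge> ln 10000" "u \<ge> 8 + 8 * C" "u > 0" using C(1) unfolding u_def by linarith+
  show ?thesis
  proof (intro exI[of _ u] conjI allI impI)
    fix X :: real assume X: "X \<ge> 2"
    define N where "N = nat \<lfloor>X\<rfloor>"
    have NX: "real N \<le> X" using X by (simp add: N_def)
    let ?S = "{n. 1 \<le> n \<and> n \<le> N \<and> lambda_star_practical n}"
    have S: "{n::nat. 1 \<le> n \<and> real n \<le> X \<and> lambda_star_practical n} = ?S"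
      using X by (auto simp: N_def le_nat_floor le_nat_iff le_floor_iff)
    have lnX: "ln X > 0" using X by simp
    have "real (card ?S) \<le> u * X / ln X"
    proof (cases "X \<le> 10000")
      case True
      have "card ?S \<le> card {1..N}" by (intro card_mono) auto
      then have "real (card ?S) \<le> X" using NX by simp
      also have "\<dots> = X * ln X / ln X" using lnX by simp
      also have "\<dots> \<le> X * u / ln X"
        using X True u(1) lnX by (intro divide_right_mono mult_left_mono order.trans[OF _ u(1)]) auto
      finally show ?thesis by (simp add: mult_ac)
    next
      case False
      define x where "x = X powr (1/4)"
      have x4: "x ^ 4 = X" using X by (simp add: x_def powr_realpow[symmetric] powr_powr)
      have x10: "x > 10"
      proof (rule ccontr)
        assume "\<not> x > 10"
        then have "x ^ 4 \<le> 10 ^ 4" by (intro power_mono) (auto simp: x_def)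
        then show False using False x4 by simp
      qed
      define T where "T = nat \<lfloor>x\<rfloor>"
      have Tx: "real T \<le> x" "x < real T + 1" using x10 by (auto simp: T_def)
      have T: "T \<ge> 9" using x10 Tx by linarith
      have "real (T ^ 4) \<le> X" using power_mono[OF Tx(1), of 4] x4 by simp
      then have TN: "T ^ 4 \<le> N" unfolding N_def by (rule le_nat_floor)
      have lnx: "ln X = 4 * ln x" using x10 by (simp add: x4[symmetric] ln_realpow)
      \<comment> \<open>The fourth root costs a factor 4, and the rounding bound
        \<open>x \<le> T^2\<close> another 2.\<close>
      have lnT: "ln X \<le> 8 * ln (real T)"
      proof -
        have "x \<le> real T * real T"
        proof -
          have "real T + 1 \<le> real T * 2" using T by simp
          also have "\<dots> \<le> real T * real T" using T by (intro mult_left_mono) auto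
          finally show ?thesis using Tx by simp
        qed
        then have "ln x \<le> ln (real T * real T)" using x10 T by (subst ln_le_cancel_iff) auto
        then show ?thesis using T lnx by (simp add: ln_mult)
      qed
      have "real (card ?S) \<le> real T + C * real N / ln (real T)"
        by (rule C(2)[OF T TN])
      also have "C * real N / ln (real T) \<le> C * X / (ln X / 8)"
        using C(1) NX lnT lnX X T by (intro frac_le mult_left_mono) auto
      also have "real T \<le> 8 * X / ln X"
      proof -
        have "ln X \<le> 4 * x" using lnx ln_le_minus_one[of x] x10 by simp
        then have "real T * ln X \<le> x * (4 * x)"
          using Tx x10 lnX by (intro mult_mono) auto
        also have "\<dots> = 4 * (x * x) * (1 * 1)" by simp
        also have "\<dots> \<le> 8 * (x * x) * (x * x)"
          using x10 by (intro mult_mono) auto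
        also have "\<dots> = 8 * X" by (simp add: x4[symmetric] eval_nat_numeral)
        finally show ?thesis using lnX by (simp add: pos_le_divide_eq)
      qed
      also have "8 * X / ln X + C * X / (ln X / 8) = (8 + 8 * C) * X / ln X"
        by (simp add: add_divide_distrib algebra_simps)
      also have "\<dots> \<le> u * X / ln X"
        using u X lnX by (intro divide_right_mono mult_right_mono) auto
      finally show ?thesis by simp
    qed
    then show "real (card {n::nat. 1 \<le> n \<and> real n \<le> X \<and> lambda_star_practical n}) \<le> u * X / ln X"
      unfolding S .
  qed (use u in auto)
qed

end
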